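(* Let $\mathcal{B}_1=\mathcal{A}_1$, $\mathcal{B}_2=\mathcal{A}_2$, and \[ \mathcal{B}'_3=(\mathcal{A}_1\times\mathcal{A}_2)\cup\{(\mathbb{Z}/4)^4,\ (\mathbb{Z}/8)^2\times\mathbb{Z}/4\times\mathbb{Z}/2,\ (\mathbb{Z}/6)^2\times(\mathbb{Z}/3)^2,\ (\mathbb{Z}/6)^3\times\mathbb{Z}/2\}. \] Then \[ (\mathcal{B}_1 \bullet \mathcal{B}_3') \cup (\mathcal{B}_2 \bullet \mathcal{B}_2) = (\mathcal{B}_1 \times \mathcal{B}_3') \cup (\mathcal{B}_2 \times \mathcal{B}_2). \]
   Context: All groups are considered up to isomorphism. For nonempty sets $\mathcal{A},\mathcal{B}$ of (isomorphism classes of) finite abelian groups, put $\mathcal{A}\times\mathcal{B}=\{H\times K \mid H\in\mathcal{A},\,K\in\mathcal{B}\}$, and let $\mathcal{A}\bullet\mathcal{B}$ be the set of all finite abelian groups $G$ for which there is an exact sequence $0\to H\to G\to K\to 0$ with $H\in\mathcal{A}$ and $K\in\mathcal{B}$ (all abelian extensions are taken). $\mathcal{A}_n$ denotes the set of isomorphism classes of finite abelian subgroups of the Cremona group $\mathrm{Cr}_n(\mathbb{C})=\mathrm{Bir}(\mathbb{P}^n_{\mathbb{C}})$, and $\mathcal{B}_n$ the set of isomorphism classes of finite abelian groups that can act faithfully on rationally connected varieties of dimension $n$ over $\mathbb{C}$; one has $\mathcal{A}_n=\mathcal{B}_n$ for $n=1,2$. It is known that $\mathcal{A}_1$ consists exactly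 of $\mathbb{Z}/k$ for $k\ge 1$ and $(\mathbb{Z}/2)^2$, and (Blanc) that $\mathcal{A}_2$ consists exactly of: (1) $\mathbb{Z}/k\times\mathbb{Z}/m$ for $k,m\ge 1$; (2) $\mathbb{Z}/2k\times(\mathbb{Z}/2)^2$ for $k\ge 1$; (3) $(\mathbb{Z}/4)^2\times\mathbb{Z}/2$; (4) $(\mathbb{Z}/3)^3$; (5) $(\mathbb{Z}/2)^4$. Here $\mathbb{Z}/2k$ denotes the cyclic group of order $2k$. *)

theory Defs
  imports
    "HOL-Algebra.Algebra"
    "HOL-Library.Poly_Mapping"
    "HOL-Computational_Algebra.Fraction_Field"
    Complex_Main
begin

definition fin_ab_group :: "('a, 'b) monoid_scheme \<Rightarrow> bool" where
  "fin_ab_group G \<longleftrightarrow> comm_group G \<and> finite (carrier G)"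

text \<open>Every finite group is isomorphic to one whose carrier is a set of natural numbers, so
  isomorphism classes of finite groups are represented by sets of groups over \<^typ>\<open>nat\<close>:
  for finite groups \<open>G\<close> and \<open>H\<close> (over arbitrary types) one has
  \<open>iso_class G = iso_class H\<close> iff \<open>G \<cong> H\<close>.\<close>

definition iso_class :: "('a, 'b) monoid_scheme \<Rightarrow> nat monoid set" where
  "iso_class G = {K. group K \<and> G \<cong> K}"

definition class_times :: "nat monoid set set \<Rightarrow> nat monoid set set \<Rightarrow> nat monoid set set"
    (infixl \<open>\<times>\<^sub>G\<close> 70) where
  "\<A> \<times>\<^sub>G \<B> = {iso_class (H \<times>\<times> K) | (H :: nat monoid) (K :: nat monoid).
      fin_ab_group H \<and> fin_ab_group K \<and> iso_class H \<in> \<A> \<and> iso_class K \<in> \<B>}"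

text \<open>The library's \<open>short_exact_sequence K G H p i\<close> lists the groups from right to left; it
  stands for \<open>0 \<longrightarrow> H \<longrightarrow> G \<longrightarrow> K \<longrightarrow> 0\<close> with the maps \<open>i\<close> and \<open>p\<close>.\<close>

definition class_ext :: "nat monoid set set \<Rightarrow> nat monoid set set \<Rightarrow> nat monoid set set"
    (infixl \<open>\<bullet>\<^sub>G\<close> 70) where
  "\<A> \<bullet>\<^sub>G \<B> = {iso_class G | G :: nat monoid. fin_ab_group G \<and>
      (\<exists>H K p i. fin_ab_group H \<and> fin_ab_group K \<and> iso_class H \<in> \<A> \<and> iso_class K \<in> \<B> \<and>
        short_exact_sequence K G H p i)}"

text \<open>The class of \<open>\<int>/n\<^sub>1 \<times> \<dots> \<times> \<int>/n\<^sub>r\<close>. All entries have to be positive, since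
  \<^term>\<open>integer_mod_group 0\<close> is infinite.\<close>

definition Zmod :: "nat list \<Rightarrow> nat monoid set" where
  "Zmod ns = iso_class (product_group {..<length ns} (\<lambda>i. integer_mod_group (ns ! i)))"

definition rational_functions :: "nat \<Rightarrow> ((nat \<Rightarrow>\<^sub>0 nat) \<Rightarrow>\<^sub>0 complex) fract set" where
  "rational_functions n = {Fract p q | p q.
      q \<noteq> 0 \<and> (\<forall>m \<in> Poly_Mapping.keys p \<union> Poly_Mapping.keys q. Poly_Mapping.keys m \<subseteq> {..<n})}"

text \<open>The Cremona group \<open>Bir(\<P>\<^sup>n)\<close> over the complex numbers, as the group of
  \<open>\<complex>\<close>-automorphisms of the function field \<open>\<complex>(x\<^sub>0, \<dots>, x\<^sub>n\<^sub>-\<^sub>1)\<close> of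
  projective \<open>n\<close>-space. Pulling back functions reverses the order of composition, so this is the
  opposite of the group of birational maps; it is isomorphic to it via inversion.\<close>

definition Cremona ::
  "nat \<Rightarrow> (((nat \<Rightarrow>\<^sub>0 nat) \<Rightarrow>\<^sub>0 complex) fract \<Rightarrow> ((nat \<Rightarrow>\<^sub>0 nat) \<Rightarrow>\<^sub>0 complex) fract) monoid" where
  "Cremona n = (BijGroup (rational_functions n))
     \<lparr>carrier := {\<sigma> \<in> Bij (rational_functions n).
        (\<forall>f \<in> rational_functions n. \<forall>g \<in> rational_functions n.
           \<sigma> (f + g) = \<sigma> f + \<sigma> g \<and> \<sigma> (f * g) = \<sigma> f * \<sigma> g) \<and>
        (\<forall>c. \<sigma> (Fract (Poly_Mapping.single 0 c) 1) = Fract (Poly_Mapping.single 0 c) 1)}\<rparr>"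

definition A_Cr :: "nat \<Rightarrow> nat monoid set set" where
  "A_Cr n = {iso_class ((Cremona n)\<lparr>carrier := H\<rparr>) | H.
      subgroup H (Cremona n) \<and> fin_ab_group ((Cremona n)\<lparr>carrier := H\<rparr>)}"

text \<open>The classification of the finite abelian subgroups of the Cremona groups of rank 1
  (classical) and rank 2 (Blanc).\<close>

definition A1_list :: "nat monoid set set" where
  "A1_list = {Zmod [k] | k. k \<ge> 1} \<union> {Zmod [2, 2]}"

definition A2_list :: "nat monoid set set" where
  "A2_list = {Zmod [k, m] | k m. k \<ge> 1 \<and> m \<ge> 1} \<union> {Zmod [2 * k, 2, 2] | k. k \<ge> 1} \<union>
     {Zmod [4, 4, 2], Zmod [3, 3, 3], Zmod [2, 2, 2, 2]}"

definition B3' :: "nat monoid set set \<Rightarrow> nat monoid set set \<Rightarrow> nat monoid set set" where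
  "B3' \<A>\<^sub>1 \<A>\<^sub>2 = (\<A>\<^sub>1 \<times>\<^sub>G \<A>\<^sub>2) \<union>
     {Zmod [4, 4, 4, 4], Zmod [8, 8, 4, 2], Zmod [6, 6, 3, 3], Zmod [6, 6, 6, 2]}"

end

theory Submission
  imports Defs
begin

text \<open>In an extension \<open>0 \<longrightarrow> H \<longrightarrow> G \<longrightarrow> K \<longrightarrow> 0\<close> of finite abelian groups the \<open>n\<close>-torsion satisfies
  \<open>|G[n]| \<le> |H[n]| |K[n]|\<close>. If \<open>n\<^sub>0, n\<^sub>1, \<dots>\<close> are the invariant factors of \<open>G\<close>, with
  \<open>n\<^sub>i\<^sub>+\<^sub>1\<close> dividing \<open>n\<^sub>i\<close>, and \<open>c(q)\<close> is the number of those divisible by \<open>q\<close>, then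
  \<open>|G[p\<^sup>t]|\<close> is \<open>p\<close> to the power \<open>c(p) + c(p\<^sup>2) + \<dots> + c(p\<^sup>t)\<close>, so the partial sums of \<open>c(p), c(p\<^sup>2), \<dots>\<close> are at most the
  corresponding sums for \<open>H \<times> K\<close>. For every pair of families in the two lists, these inequalities with
  \<open>p\<^sup>t \<in> {2, 4, 8, 16, 3, 9}\<close> and \<open>p\<^sup>t = p \<ge> 5\<close> already force the sequence of invariant factors to be
  one of those of the direct products.\<close>

section \<open>Products of cyclic groups and their torsion\<close>

text \<open>The inequalities are only a necessary condition for an extension to exist. They suffice
  because two groups \<open>Z/k x Z/m\<close> absorb every group with at most four invariant
  factors, so that only larger ranks are delicate. There the bounds are nearly exhausted: the counts
  c(p), c(p^2), ... never increase, and few sequences fit under the given partial sums. If r cyclic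
  factors of arbitrary order occur in the two families, then c(p) <= r for every prime p >= 5. Hence
  all invariant factors from index r on are products of powers of 2 and 3, and their values can be
  read off from finitely many counts. The role of \<open>(Z/4)^4\<close> shows in one example:
  joining the two factors Z/2 to a Z/4 makes \<open>(Z/4)^5\<close> an extension of
  \<open>(Z/4)^2 x Z/2\<close> by itself, and among the direct products on the right it occurs only
  as \<open>Z/4 x (Z/4)^4\<close>. The converse inclusion holds because a direct product is a split
  extension.\<close>

lemma iso_class_eqI:
  assumes "group G" "group H" "G \<cong> H"
  shows "iso_class G = iso_class H"
proof -
  have "G \<cong> K \<longleftrightarrow> H \<cong> K" for K :: "nat monoid"
    using iso_trans[OF group.iso_sym[OF assms(1,3)], of K] iso_trans[OF assms(3), of K] by blast
  then show ?thesis
    by (simp add: iso_class_def)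
qed

lemma iso_class_eqD:
  fixes K :: "nat monoid"
  assumes "iso_class G = iso_class K" "group K"
  shows "G \<cong> K"
proof -
  have "K \<in> iso_class G"
    unfolding assms(1) using assms(2) by (simp add: iso_class_def)
  then show ?thesis
    by (simp add: iso_class_def)
qed

text \<open>Fixes a concrete representative of \<open>Zmod ns\<close>, so that isomorphisms can be
  chained before passing to classes.\<close>

definition cyclic_prod :: "nat list \<Rightarrow> (nat \<Rightarrow> int) monoid" where
  "cyclic_prod ns = product_group {..<length ns} (\<lambda>i. integer_mod_group (ns ! i))"

lemma Zmod_cyclic_prod: "Zmod ns = iso_class (cyclic_prod ns)"
  by (simp add: Zmod_def cyclic_prod_def)

lemma group_cyclic_prod [simp]: "group (cyclic_prod ns)"
  by (simp add: cyclic_prod_def)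

lemma comm_group_cyclic_prod [simp]: "comm_group (cyclic_prod ns)"
  by (rule group.group_comm_groupI[OF group_cyclic_prod])
     (auto simp: cyclic_prod_def add.commute)

lemma finite_cyclic_prod:
  assumes "\<forall>n\<in>set ns. n > 0"
  shows "finite (carrier (cyclic_prod ns))"
  using assms unfolding cyclic_prod_def
  by (auto simp: carrier_integer_mod_group intro!: finite_PiE)

lemma cyclic_prod_append: "cyclic_prod (xs @ ys) \<cong> cyclic_prod xs \<times>\<times> cyclic_prod ys"
proof -
  let ?a = "length xs" and ?b = "length ys"
  let ?Z = "\<lambda>i. integer_mod_group ((xs @ ys) ! i)"
  let ?f = "\<lambda>f. (\<lambda>i\<in>{..<?a}. f i :: int, \<lambda>i\<in>{..<?b}. f (?a + i) :: int)"
  let ?g = "\<lambda>(u, v). \<lambda>i\<in>{..<?a + ?b}. if i < ?a then u i else v (i - ?a) :: int"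
  have cod: "?f ` carrier (cyclic_prod (xs @ ys)) \<subseteq> carrier (cyclic_prod xs \<times>\<times> cyclic_prod ys)"
  proof
    fix p assume "p \<in> ?f ` carrier (cyclic_prod (xs @ ys))"
    then obtain f where p: "p = ?f f" and f: "\<And>i. i < ?a + ?b \<Longrightarrow> f i \<in> carrier (?Z i)"
      by (auto simp: cyclic_prod_def PiE_iff)
    have "f i \<in> carrier (integer_mod_group (xs ! i))" if "i < ?a" for i
      using f[of i] that by (simp add: nth_append)
    moreover have "f (?a + i) \<in> carrier (integer_mod_group (ys ! i))" if "i < ?b" for i
      using f[of "?a + i"] that by (simp add: nth_append)
    ultimately show "p \<in> carrier (cyclic_prod xs \<times>\<times> cyclic_prod ys)"
      by (simp add: p cyclic_prod_def PiE_iff)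
  qed
  have "?f \<in> iso (cyclic_prod (xs @ ys)) (cyclic_prod xs \<times>\<times> cyclic_prod ys)"
  proof (rule isoI)
    show "?f \<in> hom (cyclic_prod (xs @ ys)) (cyclic_prod xs \<times>\<times> cyclic_prod ys)"
    proof (rule homI)
      fix f assume "f \<in> carrier (cyclic_prod (xs @ ys))"
      then show "?f f \<in> carrier (cyclic_prod xs \<times>\<times> cyclic_prod ys)"
        using cod by blast
    qed (auto simp: cyclic_prod_def nth_append fun_eq_iff)
    show "bij_betw ?f (carrier (cyclic_prod (xs @ ys))) (carrier (cyclic_prod xs \<times>\<times> cyclic_prod ys))"
    proof (rule bij_betw_byWitness[where f' = ?g])
      show "\<forall>f\<in>carrier (cyclic_prod (xs @ ys)). ?g (?f f) = f"
        by (auto simp: cyclic_prod_def fun_eq_iff restrict_def PiE_iff extensional_def)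
      show "\<forall>p\<in>carrier (cyclic_prod xs \<times>\<times> cyclic_prod ys). ?f (?g p) = p"
        by (auto simp: cyclic_prod_def fun_eq_iff restrict_def PiE_iff extensional_def)
      show "?f ` carrier (cyclic_prod (xs @ ys)) \<subseteq> carrier (cyclic_prod xs \<times>\<times> cyclic_prod ys)"
        by (rule cod)
      show "?g ` carrier (cyclic_prod xs \<times>\<times> cyclic_prod ys) \<subseteq> carrier (cyclic_prod (xs @ ys))"
        by (auto simp: cyclic_prod_def PiE_iff nth_append)
    qed
  qed
  then show ?thesis
    by (rule is_isoI)
qed

lemma cyclic_prod_singleton: "integer_mod_group n \<cong> cyclic_prod [n]"
proof -
  let ?f = "\<lambda>x. \<lambda>i\<in>{..<Suc 0}. x :: int"
  have carrier: "carrier (cyclic_prod [n]) = (\<Pi>\<^sub>E i\<in>{..<Suc 0}. carrier (integer_mod_group n))"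
    unfolding cyclic_prod_def by (auto intro!: PiE_cong)
  have "?f \<in> iso (integer_mod_group n) (cyclic_prod [n])"
  proof (rule isoI)
    show "?f \<in> hom (integer_mod_group n) (cyclic_prod [n])"
      by (rule homI) (auto simp: cyclic_prod_def fun_eq_iff)
    show "bij_betw ?f (carrier (integer_mod_group n)) (carrier (cyclic_prod [n]))"
    proof (rule bij_betw_byWitness[where f' = "\<lambda>f. f 0"])
      show "\<forall>f\<in>carrier (cyclic_prod [n]). ?f (f 0) = f"
      proof
        fix f assume "f \<in> carrier (cyclic_prod [n])"
        then have "f \<in> extensional {..<Suc 0}"
          unfolding carrier by (simp add: PiE_iff)
        then show "?f (f 0) = f"
          by (intro extensionalityI[where A = "{..<Suc 0}"]) auto
      qed
      show "?f ` carrier (integer_mod_group n) \<subseteq> carrier (cyclic_prod [n])"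
        unfolding carrier by (intro image_subsetI restrict_PiE_iff[THEN iffD2]) simp
      show "(\<lambda>f. f 0) ` carrier (cyclic_prod [n]) \<subseteq> carrier (integer_mod_group n)"
        unfolding carrier by (auto simp only: PiE_iff lessThan_iff)
    qed simp
  qed
  then show ?thesis
    by (rule is_isoI)
qed

lemma DirProd_iso_cong:
  assumes "group G" "G \<cong> G'" "H \<cong> H'"
  shows "G \<times>\<times> H \<cong> G' \<times>\<times> H'"
  using assms by (simp add: group.DirProd_iso_trans)

section \<open>Counting torsion in products and extensions\<close>

definition torsion_card :: "('a, 'b) monoid_scheme \<Rightarrow> nat \<Rightarrow> nat" where
  "torsion_card G n = card {x \<in> carrier G. x [^]\<^bsub>G\<^esub> n = \<one>\<^bsub>G\<^esub>}"

lemma hom_nat_pow: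
  assumes "group G" "group H" "f \<in> hom G H" "x \<in> carrier G"
  shows "f (x [^]\<^bsub>G\<^esub> (n::nat)) = f x [^]\<^bsub>H\<^esub> n"
proof -
  interpret group_hom G H f
    using assms by (simp add: group_hom_def group_hom_axioms_def)
  show ?thesis
    using assms(4) by (rule hom_nat_pow)
qed

lemma torsion_card_iso:
  assumes "group G" "group H" "G \<cong> H"
  shows "torsion_card G n = torsion_card H n"
proof -
  obtain f where f: "f \<in> hom G H" "bij_betw f (carrier G) (carrier H)"
    using assms(3) by (auto simp: is_iso_def iso_def)
  have "f x [^]\<^bsub>H\<^esub> n = \<one>\<^bsub>H\<^esub> \<longleftrightarrow> x [^]\<^bsub>G\<^esub> n = \<one>\<^bsub>G\<^esub>" if "x \<in> carrier G" for x
  proof -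
    have "f x [^]\<^bsub>H\<^esub> n = f (x [^]\<^bsub>G\<^esub> n)" "\<one>\<^bsub>H\<^esub> = f \<one>\<^bsub>G\<^esub>"
      using hom_nat_pow[OF assms(1,2) f(1) that] hom_one[OF f(1) assms(1,2)] by simp_all
    moreover have "x [^]\<^bsub>G\<^esub> n \<in> carrier G" "\<one>\<^bsub>G\<^esub> \<in> carrier G"
      using assms(1) that by (simp_all add: group.is_monoid monoid.nat_pow_closed)
    ultimately show ?thesis
      using inj_on_eq_iff[OF bij_betw_imp_inj_on[OF f(2)]] by simp
  qed
  then have "f ` {x \<in> carrier G. x [^]\<^bsub>G\<^esub> n = \<one>\<^bsub>G\<^esub>} = {y \<in> f ` carrier G. y [^]\<^bsub>H\<^esub> n = \<one>\<^bsub>H\<^esub>}"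
    by blast
  then have "f ` {x \<in> carrier G. x [^]\<^bsub>G\<^esub> n = \<one>\<^bsub>G\<^esub>} = {x \<in> carrier H. x [^]\<^bsub>H\<^esub> n = \<one>\<^bsub>H\<^esub>}"
    unfolding bij_betw_imp_surj_on[OF f(2)] .
  then have "bij_betw f {x \<in> carrier G. x [^]\<^bsub>G\<^esub> n = \<one>\<^bsub>G\<^esub>} {x \<in> carrier H. x [^]\<^bsub>H\<^esub> n = \<one>\<^bsub>H\<^esub>}"
    using f(2) by (auto intro: bij_betw_subset)
  then show ?thesis
    unfolding torsion_card_def by (rule bij_betw_same_card)
qed

lemma nat_pow_DirProd: "(x, y) [^]\<^bsub>G \<times>\<times> H\<^esub> (n::nat) = (x [^]\<^bsub>G\<^esub> n, y [^]\<^bsub>H\<^esub> n)"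
  by (induction n) (simp_all add: nat_pow_def)

lemma torsion_card_DirProd: "torsion_card (G \<times>\<times> H) n = torsion_card G n * torsion_card H n"
proof -
  have "{x \<in> carrier (G \<times>\<times> H). x [^]\<^bsub>G \<times>\<times> H\<^esub> n = \<one>\<^bsub>G \<times>\<times> H\<^esub>} =
    {x \<in> carrier G. x [^]\<^bsub>G\<^esub> n = \<one>\<^bsub>G\<^esub>} \<times> {x \<in> carrier H. x [^]\<^bsub>H\<^esub> n = \<one>\<^bsub>H\<^esub>}"
    (is "?L = ?R")
  proof -
    have "z \<in> ?L \<longleftrightarrow> z \<in> ?R" for z
      by (cases z) (simp only: nat_pow_DirProd one_DirProd carrier_DirProd mem_Collect_eq mem_Times_iff fst_conv snd_conv prod.inject, blast)
    then show ?thesis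
      by blast
  qed
  then show ?thesis
    by (simp add: torsion_card_def card_cartesian_product)
qed

text \<open>With \<open>d\<close> the gcd and \<open>q = m / d\<close>, the numbers
  \<open>n / d\<close> and \<open>q\<close> are coprime, so \<open>m\<close> divides
  \<open>n * x\<close> exactly when \<open>q\<close> divides \<open>x\<close>. Below
  \<open>m = q * d\<close> there are \<open>d\<close> such \<open>x\<close>.\<close>

lemma torsion_card_integer_mod_group:
  assumes "m > 0"
  shows "torsion_card (integer_mod_group m) n = gcd n m"
proof -
  define d q where "d = int (gcd n m)" and "q = int m div d"
  have d: "d > 0" "int m = q * d" "q > 0"
    using assms by (auto simp: d_def q_def pos_imp_zdiv_pos_iff dvd_imp_le)
  have "int m dvd int n * x \<longleftrightarrow> q dvd x" for x
  proof -
    have "coprime q (int n div d)"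
      unfolding q_def d_def using assms
      by (metis div_gcd_coprime coprime_commute gcd_int_int_eq of_nat_0_less_iff order_less_irrefl)
    moreover have "int n = (int n div d) * d"
      by (simp add: d_def)
    ultimately show ?thesis
      using d by (smt (verit) coprime_dvd_mult_right_iff dvd_times_right_cancel_iff mult.assoc mult.commute)
  qed
  then have "{x \<in> carrier (integer_mod_group m). x [^]\<^bsub>integer_mod_group m\<^esub> n = \<one>\<^bsub>integer_mod_group m\<^esub>}
    = {x. 0 \<le> x \<and> x < q * d \<and> q dvd x}"
    using assms d(2) by (auto simp: carrier_integer_mod_group mod_eq_0_iff_dvd)
  also have "\<dots> = (\<lambda>k. q * k) ` {0..<d}"
    using d(3) by (auto simp: zero_le_mult_iff elim!: dvdE)
  also have "card \<dots> = gcd n m"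
    using d(3) by (subst card_image) (auto simp: inj_on_def d_def)
  finally show ?thesis
    by (simp add: torsion_card_def)
qed

lemma torsion_card_cyclic_prod:
  assumes "\<forall>m\<in>set ms. m > 0"
  shows "torsion_card (cyclic_prod ms) n = (\<Prod>m\<leftarrow>ms. gcd n m)"
  using assms
proof (induction ms)
  case Nil
  have "{x \<in> carrier (cyclic_prod []). x [^]\<^bsub>cyclic_prod []\<^esub> n = \<one>\<^bsub>cyclic_prod []\<^esub>} = {\<one>\<^bsub>cyclic_prod []\<^esub>}"
    using monoid.nat_pow_one[OF group.is_monoid[OF group_cyclic_prod[of "[]"]]] by (auto simp: cyclic_prod_def)
  then show ?case
    by (simp add: torsion_card_def)
next
  case (Cons m ms)
  have "torsion_card (cyclic_prod (m # ms)) n = torsion_card (cyclic_prod [m] \<times>\<times> cyclic_prod ms) n"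
    using cyclic_prod_append[of "[m]" ms] by (intro torsion_card_iso) (auto intro: DirProd_group)
  also have "\<dots> = gcd n m * torsion_card (cyclic_prod ms) n"
    using Cons.prems torsion_card_iso[OF group_integer_mod_group group_cyclic_prod cyclic_prod_singleton]
    by (metis torsion_card_DirProd torsion_card_integer_mod_group list.set_intros(1))
  finally show ?case
    using Cons by simp
qed

text \<open>Two n-torsion elements in one fibre of \<open>p\<close> differ by the image under
  \<open>i\<close> of an n-torsion element of \<open>H\<close>, so no fibre over \<open>?TK\<close>
  has more than \<open>card ?TH\<close> of them. Equality can fail, since an n-torsion element of
  \<open>K\<close> may have no n-torsion preimage, as in Z/4 over Z/2.\<close>

lemma torsion_card_extension:
  assumes "fin_ab_group G" "fin_ab_group H" "fin_ab_group K" "short_exact_sequence K G H p i"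
  shows "torsion_card G n \<le> torsion_card H n * torsion_card K n"
proof -
  interpret G: comm_group G using assms(1) by (simp add: fin_ab_group_def)
  interpret H: comm_group H using assms(2) by (simp add: fin_ab_group_def)
  interpret K: comm_group K using assms(3) by (simp add: fin_ab_group_def)
  have ex: "kernel G K p = i ` carrier H" "p \<in> hom G K" "i \<in> hom H G" "inj_on i (carrier H)"
    using short_exact_sequenceD[OF assms(4)] by (auto simp: epi_def mon_def)
  interpret p: group_hom G K p
    using ex(2) by (simp add: group_hom_def group_hom_axioms_def G.is_group K.is_group)
  interpret i: group_hom H G i
    using ex(3) by (simp add: group_hom_def group_hom_axioms_def G.is_group H.is_group)
  let ?TG = "{x \<in> carrier G. x [^]\<^bsub>G\<^esub> n = \<one>\<^bsub>G\<^esub>}"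
  let ?TH = "{x \<in> carrier H. x [^]\<^bsub>H\<^esub> n = \<one>\<^bsub>H\<^esub>}"
  let ?TK = "{x \<in> carrier K. x [^]\<^bsub>K\<^esub> n = \<one>\<^bsub>K\<^esub>}"
  have fin: "finite ?TG" "finite ?TH" "finite ?TK"
    using assms(1-3) by (simp_all add: fin_ab_group_def)
  have fibre: "card {x \<in> ?TG. p x = y} \<le> card ?TH" for y
  proof (cases "{x \<in> ?TG. p x = y} = {}")
    case True
    then show ?thesis
      unfolding True by simp
  next
    case False
    then obtain z where z: "z \<in> carrier G" "z [^]\<^bsub>G\<^esub> n = \<one>\<^bsub>G\<^esub>" "p z = y"
      by blast
    have "{x \<in> ?TG. p x = y} \<subseteq> (\<lambda>h. i h \<otimes>\<^bsub>G\<^esub> z) ` ?TH"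
    proof
      fix x assume "x \<in> {x \<in> ?TG. p x = y}"
      then have x: "x \<in> carrier G" "x [^]\<^bsub>G\<^esub> n = \<one>\<^bsub>G\<^esub>" "p x = y"
        by auto
      let ?d = "x \<otimes>\<^bsub>G\<^esub> inv\<^bsub>G\<^esub> z"
      have "p ?d = p x \<otimes>\<^bsub>K\<^esub> inv\<^bsub>K\<^esub> p z"
        using x(1) z(1) by simp
      then have "p ?d = \<one>\<^bsub>K\<^esub>"
        using p.hom_closed[OF x(1)] by (simp only: x(3) z(3) K.r_inv)
      then have "?d \<in> i ` carrier H"
        using x(1) z(1) by (simp add: ex(1)[symmetric] kernel_def)
      then obtain h where h: "h \<in> carrier H" "?d = i h"
        by blast
      have "i (h [^]\<^bsub>H\<^esub> n) = ?d [^]\<^bsub>G\<^esub> n"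
        using h by (simp add: i.hom_nat_pow)
      also have "\<dots> = \<one>\<^bsub>G\<^esub>"
        using x z by (simp add: G.pow_mult_distrib G.m_comm G.nat_pow_inv)
      finally have "h [^]\<^bsub>H\<^esub> n = \<one>\<^bsub>H\<^esub>"
        using h ex(4) by (metis H.nat_pow_closed H.one_closed i.hom_one inj_onD)
      moreover have "x = i h \<otimes>\<^bsub>G\<^esub> z"
        using x z h by (metis G.inv_closed G.inv_solve_right i.hom_closed)
      ultimately show "x \<in> (\<lambda>h. i h \<otimes>\<^bsub>G\<^esub> z) ` ?TH"
        using h by blast
    qed
    then show ?thesis
      using fin(2) surj_card_le by blast
  qed
  have "p ` ?TG \<subseteq> ?TK"
    by (auto simp flip: p.hom_nat_pow)
  then have "?TG = (\<Union>y\<in>?TK. {x \<in> ?TG. p x = y})"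
    by blast
  then have "card ?TG = card (\<Union>y\<in>?TK. {x \<in> ?TG. p x = y})"
    by (rule arg_cong)
  also have "\<dots> \<le> (\<Sum>y\<in>?TK. card {x \<in> ?TG. p x = y})"
    by (rule card_UN_le[OF fin(3)])
  also have "\<dots> \<le> (\<Sum>y\<in>?TK. card ?TH)"
    by (rule sum_mono) (rule fibre)
  finally show ?thesis
    by (simp add: torsion_card_def mult.commute)
qed

text \<open>Products and extensions of classes quantify over groups on \<open>nat\<close>, whereas
  \<open>cyclic_prod\<close> and direct products live on other types. This moves them there.\<close>

lemma finite_group_nat_copy:
  assumes "fin_ab_group G"
  obtains K :: "nat monoid" where "fin_ab_group K" "G \<cong> K"
proof -
  interpret comm_group G
    using assms by (simp add: fin_ab_group_def)
  have fin: "finite (carrier G)"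
    using assms by (simp add: fin_ab_group_def)
  then obtain f :: "'a \<Rightarrow> nat" where f: "inj_on f (carrier G)"
    using finite_imp_inj_to_nat_seg by blast
  have iso: "f \<in> iso G (image_group f G)"
    by (rule inj_imp_image_group_iso) (rule f)
  have "comm_group (image_group f G)"
    using iso_imp_img_comm_group[OF iso] by (simp add: image_group_def)
  then have "fin_ab_group (image_group f G)"
    using fin by (simp add: fin_ab_group_def image_group_carrier)
  then show ?thesis
    using that iso by (blast intro: is_isoI)
qed

section \<open>Invariant factors\<close>

text \<open>Raising to the power \<open>?n * ord y\<close> kills \<open>x \<otimes> y\<close> and
  \<open>y\<close>, hence also \<open>x\<close>. So \<open>ord x\<close> divides
  \<open>?n * ord y\<close>, and by coprimality \<open>?n\<close>; the same holds with the roles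
  exchanged.\<close>

lemma (in comm_group) ord_mult_coprime:
  assumes "x \<in> carrier G" "y \<in> carrier G" "coprime (ord x) (ord y)"
  shows "ord (x \<otimes> y) = ord x * ord y"
proof -
  let ?n = "ord (x \<otimes> y)"
  have eq: "x [^] k \<otimes> y [^] k = \<one>" if "?n dvd k" for k :: nat
    using assms that by (metis m_closed pow_eq_id pow_mult_distrib m_comm)
  have "ord x dvd ?n * ord y"
  proof -
    have "x [^] (?n * ord y) \<otimes> y [^] (?n * ord y) = \<one>"
      by (rule eq) simp
    moreover have "y [^] (?n * ord y) = \<one>"
      using assms pow_eq_id by simp
    ultimately show ?thesis
      using assms pow_eq_id by simp
  qed
  moreover have "ord y dvd ?n * ord x"
  proof -
    have "x [^] (?n * ord x) \<otimes> y [^] (?n * ord x) = \<one>"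
      by (rule eq) simp
    moreover have "x [^] (?n * ord x) = \<one>"
      using assms pow_eq_id by simp
    ultimately show ?thesis
      using assms pow_eq_id by simp
  qed
  ultimately have "ord x dvd ?n" "ord y dvd ?n"
    using assms(3) by (auto simp: coprime_dvd_mult_left_iff coprime_commute)
  then have "ord x * ord y dvd ?n"
    using assms(3) by (simp add: divides_mult)
  then show ?thesis
    using abelian_ord_mul_divides[OF assms(1,2)] by (simp add: dvd_antisym)
qed

text \<open>If \<open>ord y\<close> did not divide the maximal order \<open>e\<close>, some prime
  \<open>p\<close> would have a larger multiplicity in \<open>ord y\<close>. Replacing the p-part of
  \<open>x\<close> by that of \<open>y\<close> then yields an element of order greater than
  \<open>e\<close>.\<close>

lemma (in comm_group) exists_element_of_maximal_order:
  assumes fin: "finite (carrier G)"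
  obtains x where "x \<in> carrier G" "\<And>y. y \<in> carrier G \<Longrightarrow> y [^] ord x = \<one>"
proof -
  have ne: "ord ` carrier G \<noteq> {}" "finite (ord ` carrier G)"
    using fin by auto
  define e where "e = Max (ord ` carrier G)"
  obtain x where x: "x \<in> carrier G" "ord x = e"
    using Max_in[OF ne(2,1)] by (auto simp: e_def)
  have le: "ord y \<le> e" if "y \<in> carrier G" for y
    using that ne by (simp add: e_def)
  have e: "e > 0"
    using ord_ge_1[OF fin x(1)] x(2) by simp
  have "ord y dvd e" if y: "y \<in> carrier G" for y
  proof (rule ccontr)
    assume "\<not> ord y dvd e"
    moreover have oy: "ord y > 0"
      using ord_ge_1[OF fin y] by simp
    ultimately obtain p where p: "Factorial_Ring.prime p" "multiplicity p e < multiplicity p (ord y)"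
      using e by (metis multiplicity_le_imp_dvd not_le_imp_less order_less_irrefl)
    let ?v = "multiplicity p e" and ?w = "multiplicity p (ord y)"
    obtain a where a: "e = p ^ ?v * a" "\<not> p dvd a"
      using e p(1) by (metis multiplicity_decompose' not_prime_unit order_less_irrefl)
    obtain b where b: "ord y = p ^ ?w * b"
      using multiplicity_dvd by (metis dvdE)
    have pos: "p > 0" "b > 0"
      using p(1) b oy by (auto intro: prime_gt_0_nat Nat.gr0I)
    have 1: "ord (x [^] (p ^ ?v)) = a"
      using ord_pow[OF x(1), of "p ^ ?v"] a x(2) pos by (metis dvd_triv_left nonzero_mult_div_cancel_left power_not_zero not_gr_zero)
    have 2: "ord (y [^] b) = p ^ ?w"
      using ord_pow[OF y, of b] b pos by (metis dvd_triv_right nonzero_mult_div_cancel_right not_gr_zero)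
    have "coprime a (p ^ ?w)"
      using p(1) a(2) by (metis coprime_commute coprime_power_right_iff prime_imp_coprime)
    then have "ord (x [^] (p ^ ?v) \<otimes> y [^] b) = a * p ^ ?w"
      using ord_mult_coprime[of "x [^] (p ^ ?v)" "y [^] b"] x y 1 2 by simp
    then have "a * p ^ ?w \<le> a * p ^ ?v"
      using le[of "x [^] (p ^ ?v) \<otimes> y [^] b"] x(1) y a(1) by (simp add: mult.commute)
    moreover have "a > 0"
      using a(1) e by (auto intro: Nat.gr0I)
    ultimately have "p ^ ?w \<le> p ^ ?v"
      by simp
    then show False
      using p prime_gt_1_nat[OF p(1)] by simp
  qed
  then show ?thesis
    using that x pow_eq_id by metis
qed

text \<open>A subgroup maximal among those meeting \<open>\<langle>x\<rangle>\<close> trivially is a complement: an element of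
  prime order modulo \<open>N\<langle>x\<rangle>\<close> can be corrected by a power of \<open>x\<close> to have its \<open>p\<close>-th power in \<open>N\<close>,
  because the order of \<open>x\<close> is the exponent of the group.\<close>

lemma (in comm_group) maximal_order_complement:
  assumes fin: "finite (carrier G)" and x: "x \<in> carrier G"
    and exp: "\<And>y. y \<in> carrier G \<Longrightarrow> y [^] ord x = \<one>"
  obtains N where "subgroup N G" "N \<inter> range (\<lambda>k::int. x [^] k) = {\<one>}"
    "N <#> range (\<lambda>k::int. x [^] k) = carrier G"
proof -
  let ?C = "range (\<lambda>k::int. x [^] k)"
  let ?e = "ord x"
  interpret C: subgroup ?C G
    using x by (rule subgroup_of_powers)
  define P where "P = (\<lambda>N. subgroup N G \<and> N \<inter> ?C = {\<one>})"
  have "P {\<one>}"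
    using triv_subgroup C.one_closed by (auto simp: P_def)
  moreover have "\<forall>N. P N \<longrightarrow> card N < Suc (card (carrier G))"
    using card_mono[OF fin subgroup.subset] by (auto simp: P_def less_Suc_eq_le)
  ultimately have "\<exists>N. P N \<and> (\<forall>M. P M \<longrightarrow> card M \<le> card N)"
    by (rule ex_has_greatest_nat)
  then obtain N where N: "P N" "\<And>M. P M \<Longrightarrow> card M \<le> card N"
    by auto
  interpret N: subgroup N G
    using N(1) by (simp add: P_def)
  have NC: "N \<inter> ?C = {\<one>}"
    using N(1) by (simp add: P_def)
  have NC': "x [^] a = \<one>" if "x [^] a \<in> N" for a :: int
    using that NC by blast
  let ?S = "N <#> ?C"
  interpret S: subgroup ?S G
    by (rule mult_subgroups) unfold_locales
  have NS: "N \<subseteq> ?S" and CS: "?C \<subseteq> ?S"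
    using N.one_closed C.one_closed unfolding set_mult_def
    by (auto, metis N.mem_carrier r_one rangeI int_pow_0, metis C.mem_carrier l_one rangeI)
  have e: "?e > 0"
    using ord_ge_1[OF fin x] by simp
  have pow_pow: "(x [^] a) [^] (k::nat) = x [^] (a * int k)" for a :: int and k
    using x by (metis int_pow_int int_pow_pow)
  have "carrier G \<subseteq> ?S"
  proof (rule ccontr)
    assume "\<not> carrier G \<subseteq> ?S"
    then obtain g where g: "g \<in> carrier G" "g \<notin> ?S"
      by blast
    \<comment> \<open>By minimality of \<open>m\<close>, for a prime \<open>p\<close> dividing it
      the power \<open>g [^] (m div p)\<close> is outside \<open>?S\<close> while its p-th power is
      inside. Requiring \<open>m dvd ?e\<close> makes \<open>p\<close> a divisor of the order of
      \<open>x\<close>.\<close>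
    define m where "m = (LEAST m. m > 0 \<and> m dvd ?e \<and> g [^] m \<in> ?S)"
    have "?e > 0 \<and> ?e dvd ?e \<and> g [^] ?e \<in> ?S"
      using e exp[OF g(1)] S.one_closed by simp
    then have m: "m > 0" "m dvd ?e" "g [^] m \<in> ?S"
      unfolding m_def by (metis (mono_tags, lifting) LeastI)+
    have least: "\<not> (k dvd ?e \<and> g [^] k \<in> ?S)" if "k > 0" "k < m" for k
      using that not_less_Least unfolding m_def by blast
    have "m \<noteq> 1"
      using m(3) g by auto
    then obtain p where p: "Factorial_Ring.prime p" "p dvd m"
      by (metis prime_factor_nat)
    define h where "h = g [^] (m div p)"
    have h: "h \<in> carrier G" "h \<notin> ?S"
      using g least[of "m div p"] m p prime_gt_1_nat[OF p(1)]
      by (auto simp: h_def div_le_mono dvd_div_eq_0_iff elim!: dvdE intro: dvd_trans)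
    have hp: "h [^] p = g [^] m"
      using p(2) g(1) by (simp add: h_def nat_pow_pow)
    obtain f where f: "?e = p * f"
      using p(2) m(2) by (meson dvdE dvd_trans)
    have f0: "f > 0" "p > 0"
      using f e by (auto intro: Nat.gr0I)
    obtain n a where n: "n \<in> N" "h [^] p = n \<otimes> x [^] (a::int)"
      using m(3) hp by (auto simp: set_mult_def)
    \<comment> \<open>As \<open>p * f\<close> is the exponent, this shows that
      \<open>x [^] (a * int f)\<close> lies in \<open>N\<close> and so is trivial. Hence
      \<open>p * f\<close> divides \<open>a * f\<close>, and \<open>x [^] a\<close> is the p-th
      power of \<open>x [^] b\<close>, by which \<open>h\<close> is corrected to
      \<open>k\<close>.\<close>
    have "\<one> = (h [^] p) [^] f"
      using exp[OF h(1)] h(1) f by (simp add: nat_pow_pow)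
    also have "\<dots> = n [^] f \<otimes> x [^] (a * int f)"
      using n x by (simp add: pow_mult_distrib m_comm pow_pow)
    finally have "x [^] (a * int f) = inv (n [^] f)"
      using n x by (metis N.mem_carrier inv_equality inv_inv int_pow_closed nat_pow_closed)
    moreover have "inv (n [^] f) \<in> N"
      using subgroup_int_pow_closed[OF N.subgroup_axioms n(1), of "int f"]
      by (simp add: int_pow_int)
    ultimately have "x [^] (a * int f) = \<one>"
      by (intro NC') simp
    then have "int p * int f dvd a * int f"
      using int_pow_eq_id[OF x, of "a * int f"] f by simp
    then obtain b where b: "a = int p * b"
      using f0 by auto
    define k where "k = h \<otimes> x [^] (- b)"
    have k: "k \<in> carrier G"
      using h x by (simp add: k_def)
    have "k [^] p = h [^] p \<otimes> x [^] (- b * int p)"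
      using h x by (simp add: k_def pow_mult_distrib m_comm pow_pow)
    also have "\<dots> = n \<otimes> (x [^] a \<otimes> x [^] (- a))"
      using n x b by (simp add: m_assoc mult.commute)
    also have "\<dots> = n"
      using n x by (simp add: int_pow_mult[symmetric])
    finally have kp: "k [^] p \<in> N"
      using n(1) by simp
    have kS: "k \<notin> ?S"
    proof
      assume "k \<in> ?S"
      then have "k \<otimes> x [^] b \<in> ?S"
        using CS by (intro S.m_closed) auto
      also have "k \<otimes> x [^] b = h"
        using h x by (simp add: k_def m_assoc int_pow_mult[symmetric])
      finally show False
        using h by simp
    qed
    let ?K = "range (\<lambda>j::int. k [^] j)"
    interpret K: subgroup ?K G
      using k by (rule subgroup_of_powers)
    have "subgroup (N <#> ?K) G"
      by (rule mult_subgroups) unfold_locales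
    moreover have "(N <#> ?K) \<inter> ?C \<subseteq> {\<one>}"
    proof
      fix z assume "z \<in> (N <#> ?K) \<inter> ?C"
      then obtain n' j c where z: "n' \<in> N" "z = n' \<otimes> k [^] (j::int)" "z = x [^] (c::int)"
        by (auto simp: set_mult_def)
      \<comment> \<open>Otherwise Bezout writes \<open>k\<close> as a product of powers of
        \<open>k [^] p\<close> and \<open>k [^] j\<close>, both in \<open>?S\<close>, against
        \<open>kS\<close>. Once \<open>p\<close> divides \<open>j\<close>, the element
        \<open>k [^] j\<close> is in \<open>N\<close>, and \<open>z\<close> lies in both
        \<open>N\<close> and \<open>?C\<close>.\<close>
      have "int p dvd j"
      proof (rule ccontr)
        assume "\<not> int p dvd j"
        then have "coprime (int p) j"
          using p(1) by (simp add: prime_imp_coprime)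
        then obtain u v where uv: "u * int p + v * j = 1"
          by (metis bezout_int coprime_imp_gcd_eq_1)
        have "k [^] j = inv n' \<otimes> z"
          using z k by (simp add: inv_solve_left)
        then have "k [^] j \<in> ?S"
          using z(3) subsetD[OF NS N.m_inv_closed[OF z(1)]] CS by (metis S.m_closed rangeI subsetD)
        moreover have "k [^] int p \<in> ?S"
          using kp NS by (auto simp: int_pow_int)
        ultimately have "(k [^] int p) [^] u \<otimes> (k [^] j) [^] v \<in> ?S"
          by (simp add: S.m_closed subgroup_int_pow_closed S.subgroup_axioms)
        also have "(k [^] int p) [^] u \<otimes> (k [^] j) [^] v = k [^] (1::int)"
          using k uv by (simp add: int_pow_pow int_pow_mult[symmetric] mult.commute)
        finally show False
          using kS k by simp
      qed
      then obtain i where "j = int p * i"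
        by blast
      then have "k [^] j = (k [^] p) [^] i"
        using k by (simp add: int_pow_pow flip: int_pow_int)
      then have "k [^] j \<in> N"
        using kp by (simp add: subgroup_int_pow_closed N.subgroup_axioms)
      then have "x [^] c \<in> N"
        using z(1) z(2) unfolding z(3)[symmetric] by simp
      then show "z \<in> {\<one>}"
        using NC' z(3) by simp
    qed
    moreover have "\<one> \<in> (N <#> ?K) \<inter> ?C"
      using calculation(1) C.one_closed by (simp add: subgroup.one_closed)
    ultimately have "P (N <#> ?K)"
      unfolding P_def by blast
    then have "card (N <#> ?K) \<le> card N"
      by (rule N(2))
    moreover have "N \<subset> N <#> ?K"
    proof -
      have "n \<in> N <#> ?K" if "n \<in> N" for n
        using that N.mem_carrier[OF that] K.one_closed unfolding set_mult_def by (metis (no_types, lifting) UN_iff r_one singletonI)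
      moreover have "k \<in> N <#> ?K"
        using k N.one_closed unfolding set_mult_def by (metis (no_types, lifting) UN_iff l_one singletonI rangeI int_pow_1)
      ultimately show ?thesis
        using kS NS by blast
    qed
    ultimately show False
      using fin \<open>P (N <#> ?K)\<close> by (metis P_def finite_subset not_le psubset_card_mono subgroup.subset)
  qed
  then have "?S = carrier G"
    using S.subset by blast
  then show ?thesis
    using that NC N.subgroup_axioms by blast
qed

lemma (in group) integer_mod_group_iso_powers:
  assumes "finite (carrier G)" "x \<in> carrier G"
  shows "integer_mod_group (ord x) \<cong> subgroup_generated G (range (\<lambda>k::int. x [^] k))"
proof -
  let ?C = "range (\<lambda>k::int. x [^] k)"
  interpret C: subgroup ?C G
    using assms(2) by (rule subgroup_of_powers)
  have e: "ord x > 0"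
    using ord_ge_1[OF assms] by simp
  have red: "x [^] (k mod int (ord x)) = x [^] k" for k :: int
    using assms(2) by (simp add: int_pow_eq minus_mod_eq_mult_div)
  have C: "carrier (subgroup_generated G ?C) = ?C"
    by (rule C.carrier_subgroup_generated_subgroup)
  have "([^]) x \<in> iso (integer_mod_group (ord x)) (subgroup_generated G ?C)"
  proof (rule isoI)
    show "([^]) x \<in> hom (integer_mod_group (ord x)) (subgroup_generated G ?C)"
      by (rule homI) (use assms(2) C in \<open>auto simp: red int_pow_mult\<close>)
    have "inj_on (\<lambda>k::int. x [^] k) {0..<int (ord x)}"
    proof (rule inj_onI)
      fix k l assume kl: "k \<in> {0..<int (ord x)}" "l \<in> {0..<int (ord x)}" "x [^] k = x [^] l"
      then have "int (ord x) dvd l - k"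
        using assms(2) by (simp add: int_pow_eq)
      then have "l mod int (ord x) = k mod int (ord x)"
        by (rule mod_eq_dvd_iff[THEN iffD2])
      then show "k = l"
        using kl by (metis atLeastLessThan_iff mod_pos_pos_trivial)
    qed
    moreover have "?C = (\<lambda>k::int. x [^] k) ` {0..<int (ord x)}"
    proof
      show "?C \<subseteq> (\<lambda>k::int. x [^] k) ` {0..<int (ord x)}"
      proof clarify
        fix k :: int
        show "x [^] k \<in> (\<lambda>k::int. x [^] k) ` {0..<int (ord x)}"
          using e by (intro image_eqI[where x = "k mod int (ord x)"]) (simp_all add: red)
      qed
    qed blast
    ultimately show "bij_betw (([^]) x) (carrier (integer_mod_group (ord x))) (carrier (subgroup_generated G ?C))"
      unfolding C using e by (simp add: bij_betw_def carrier_integer_mod_group)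
  qed
  then show ?thesis
    by (rule is_isoI)
qed

text \<open>Induction step for the decomposition: \<open>N\<close> is proper because
  \<open>x\<close> lies outside it, and the exponent property of \<open>ord x\<close> is kept in
  order to compare it with the factors of \<open>N\<close>.\<close>

lemma (in comm_group) cyclic_splitting:
  assumes fin: "finite (carrier G)" and nontrivial: "carrier G \<noteq> {\<one>}"
  obtains x N where "x \<in> carrier G" "ord x > 1" "\<And>y. y \<in> carrier G \<Longrightarrow> y [^] ord x = \<one>"
    "subgroup N G" "N \<subset> carrier G"
    "G \<cong> cyclic_prod [ord x] \<times>\<times> subgroup_generated G N"
proof -
  obtain x where x: "x \<in> carrier G" "\<And>y. y \<in> carrier G \<Longrightarrow> y [^] ord x = \<one>"
    using exists_element_of_maximal_order[OF fin] by blast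
  have "ord x \<noteq> 1"
  proof
    assume "ord x = 1"
    then have "\<forall>y\<in>carrier G. y = \<one>"
      using x(2) by simp
    then show False
      using nontrivial one_closed by blast
  qed
  then have e: "ord x > 1"
    using ord_ge_1[OF fin x(1)] by simp
  let ?C = "range (\<lambda>k::int. x [^] k)"
  obtain N where N: "subgroup N G" "N \<inter> ?C = {\<one>}" "N <#> ?C = carrier G"
    using maximal_order_complement[OF fin x] by blast
  interpret S: group_disjoint_sum G N ?C
    using N(1) subgroup_of_powers[OF x(1)] by (simp add: group_disjoint_sum_def is_group)
  have "x \<in> ?C"
    by (metis int_pow_1 rangeI x(1))
  then have "x \<notin> N"
    using N(2) e by (metis IntI ord_id singletonD less_irrefl)
  then have "N \<subset> carrier G"
    using x(1) S.AG.subset by blast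
  moreover have "G \<cong> cyclic_prod [ord x] \<times>\<times> subgroup_generated G N"
  proof -
    have "subgroup_generated G N \<times>\<times> subgroup_generated G ?C \<cong> G"
      using S.iso_group_mul[OF comm_group_axioms] N(2,3) by (auto intro: is_isoI)
    then have "G \<cong> subgroup_generated G N \<times>\<times> subgroup_generated G ?C"
      by (rule group.iso_sym[OF DirProd_group[OF group_subgroup_generated group_subgroup_generated]])
    also have "\<dots> \<cong> subgroup_generated G ?C \<times>\<times> subgroup_generated G N"
      by (rule DirProd_commute_iso)
    also have "\<dots> \<cong> cyclic_prod [ord x] \<times>\<times> subgroup_generated G N"
    proof (rule DirProd_iso_cong)
      have "subgroup_generated G ?C \<cong> integer_mod_group (ord x)"
        by (rule group.iso_sym[OF group_integer_mod_group integer_mod_group_iso_powers[OF fin x(1)]])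
      also note cyclic_prod_singleton
      finally show "subgroup_generated G ?C \<cong> cyclic_prod [ord x]" .
    qed auto
    finally show ?thesis .
  qed
  ultimately show ?thesis
    using that x e N(1) by blast
qed

lemma nat_pow_subgroup_generated: "y [^]\<^bsub>subgroup_generated G N\<^esub> (k::nat) = y [^]\<^bsub>G\<^esub> k"
  by (simp add: nat_pow_def subgroup_generated_def)

theorem invariant_factor_decomposition:
  fixes G :: "('a, 'b) monoid_scheme"
  assumes "fin_ab_group G"
  obtains ns where "G \<cong> cyclic_prod ns" "\<forall>n\<in>set ns. n > 1" "sorted_wrt (\<lambda>a b. b dvd a) ns"
proof -
  \<comment> \<open>The last clause, on exponents \<open>e\<close>, strengthens the induction: the
    order of the split-off \<open>x\<close> annihilates the complement, so it is a multiple of every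
    later factor.\<close>
  have "\<exists>ns. G \<cong> cyclic_prod ns \<and> (\<forall>n\<in>set ns. n > 1) \<and> sorted_wrt (\<lambda>a b. b dvd a) ns \<and>
      (\<forall>e. (\<forall>x\<in>carrier G. x [^]\<^bsub>G\<^esub> e = \<one>\<^bsub>G\<^esub>) \<longrightarrow> (\<forall>n\<in>set ns. n dvd e))"
    using assms
  proof (induction "card (carrier G)" arbitrary: G rule: less_induct)
    case (less G)
    interpret comm_group G
      using less.prems by (simp add: fin_ab_group_def)
    have fin: "finite (carrier G)"
      using less.prems by (simp add: fin_ab_group_def)
    show ?case
    proof (cases "carrier G = {\<one>\<^bsub>G\<^esub>}")
      case True
      then have "(\<lambda>_. \<lambda>i\<in>{}. undefined) \<in> iso G (cyclic_prod [])"
        by (intro isoI homI) (auto simp: cyclic_prod_def bij_betw_def)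
      then show ?thesis
        by (intro exI[where x = "[]"]) (auto intro: is_isoI)
    next
      case False
      then obtain x N where x: "x \<in> carrier G" "ord x > 1"
          "\<And>y. y \<in> carrier G \<Longrightarrow> y [^]\<^bsub>G\<^esub> ord x = \<one>\<^bsub>G\<^esub>"
        and N: "subgroup N G" "N \<subset> carrier G" "G \<cong> cyclic_prod [ord x] \<times>\<times> subgroup_generated G N"
        using cyclic_splitting[OF fin] by blast
      let ?N = "subgroup_generated G N"
      have cN: "carrier ?N = N"
        using N(1) by (rule subgroup.carrier_subgroup_generated_subgroup)
      have "card (carrier ?N) < card (carrier G)"
        using N(2) fin by (simp add: cN psubset_card_mono)
      moreover have "fin_ab_group ?N"
        using fin N(2) by (auto simp: fin_ab_group_def cN finite_subset abelian_subgroup_generated comm_group_axioms)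
      ultimately obtain ms where ms: "?N \<cong> cyclic_prod ms" "\<forall>n\<in>set ms. n > 1"
        "sorted_wrt (\<lambda>a b. b dvd a) ms"
        "\<And>e. (\<forall>x\<in>carrier ?N. x [^]\<^bsub>?N\<^esub> e = \<one>\<^bsub>?N\<^esub>) \<Longrightarrow> (\<forall>n\<in>set ms. n dvd e)"
        using less.hyps by blast
      have ms_dvd: "\<forall>n\<in>set ms. n dvd k" if "\<forall>y\<in>carrier G. y [^]\<^bsub>G\<^esub> k = \<one>\<^bsub>G\<^esub>" for k
        by (rule ms(4)) (use that N(2) cN in \<open>auto simp: nat_pow_subgroup_generated\<close>)
      note N(3)
      also have "cyclic_prod [ord x] \<times>\<times> ?N \<cong> cyclic_prod [ord x] \<times>\<times> cyclic_prod ms"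
        using ms(1) by (intro DirProd_iso_cong) auto
      also have "\<dots> \<cong> cyclic_prod (ord x # ms)"
        using group.iso_sym[OF _ cyclic_prod_append[of "[ord x]" ms]] by simp
      finally have "G \<cong> cyclic_prod (ord x # ms)" .
      moreover have "ord x dvd k" if "\<forall>y\<in>carrier G. y [^]\<^bsub>G\<^esub> k = \<one>\<^bsub>G\<^esub>" for k
        using that x(1) by (simp add: pow_eq_id)
      ultimately show ?thesis
        using x(2,3) ms(2,3) ms_dvd by (intro exI[where x = "ord x # ms"]) auto
    qed
  qed
  then show ?thesis
    using that by blast
qed

section \<open>Classes of products and extensions\<close>

lemma Zmod_eqI: "cyclic_prod xs \<cong> cyclic_prod ys \<Longrightarrow> Zmod xs = Zmod ys"
  unfolding Zmod_cyclic_prod by (intro iso_class_eqI) simp_all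

lemma Zmod_swap: "Zmod (xs @ ys) = Zmod (ys @ xs)"
proof (rule Zmod_eqI)
  have "cyclic_prod (xs @ ys) \<cong> cyclic_prod xs \<times>\<times> cyclic_prod ys"
    by (rule cyclic_prod_append)
  also have "\<dots> \<cong> cyclic_prod ys \<times>\<times> cyclic_prod xs"
    by (rule DirProd_commute_iso)
  also have "\<dots> \<cong> cyclic_prod (ys @ xs)"
    by (rule group.iso_sym[OF group_cyclic_prod cyclic_prod_append])
  finally show "cyclic_prod (xs @ ys) \<cong> cyclic_prod (ys @ xs)" .
qed

lemma cyclic_prod_ones: "cyclic_prod (replicate k 1 @ xs) \<cong> cyclic_prod xs"
proof (induction k)
  case (Suc k)
  have "(\<lambda>y. (\<lambda>i\<in>{..<Suc 0}. 0, y)) \<in> iso (cyclic_prod xs) (cyclic_prod [1] \<times>\<times> cyclic_prod xs)"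
  proof (rule isoI)
    have 1: "carrier (cyclic_prod [1]) = {\<lambda>i\<in>{..<Suc 0}. 0}"
      unfolding cyclic_prod_def
      by (auto simp: carrier_integer_mod_group lessThan_Suc PiE_eq_singleton)
    show "(\<lambda>y. (\<lambda>i\<in>{..<Suc 0}. 0, y)) \<in> hom (cyclic_prod xs) (cyclic_prod [1] \<times>\<times> cyclic_prod xs)"
    proof (rule homI)
      fix x y
      have "\<one>\<^bsub>cyclic_prod [1]\<^esub> = (\<lambda>i\<in>{..<Suc 0}. 0)"
        by (simp add: cyclic_prod_def)
      then have "(\<lambda>i\<in>{..<Suc 0}. 0) \<otimes>\<^bsub>cyclic_prod [1]\<^esub> (\<lambda>i\<in>{..<Suc 0}. 0) = (\<lambda>i\<in>{..<Suc 0}. 0)"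
        using monoid.r_one[OF group.is_monoid[OF group_cyclic_prod[of "[1]"]], of "\<lambda>i\<in>{..<Suc 0}. 0"] 1 by simp
      then show "(\<lambda>i\<in>{..<Suc 0}. 0, x \<otimes>\<^bsub>cyclic_prod xs\<^esub> y) =
          (\<lambda>i\<in>{..<Suc 0}. 0, x) \<otimes>\<^bsub>cyclic_prod [1] \<times>\<times> cyclic_prod xs\<^esub> (\<lambda>i\<in>{..<Suc 0}. 0, y)"
        by simp
    qed (unfold carrier_DirProd 1, simp)
    show "bij_betw (\<lambda>y. (\<lambda>i\<in>{..<Suc 0}. 0, y)) (carrier (cyclic_prod xs)) (carrier (cyclic_prod [1] \<times>\<times> cyclic_prod xs))"
      unfolding carrier_DirProd 1 by (auto simp: bij_betw_def inj_on_def)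
  qed
  then have "cyclic_prod [1] \<times>\<times> cyclic_prod xs \<cong> cyclic_prod xs"
    by (intro group.iso_sym[OF group_cyclic_prod is_isoI])
  have "cyclic_prod (replicate (Suc k) 1 @ xs) \<cong> cyclic_prod [1] \<times>\<times> cyclic_prod (replicate k 1 @ xs)"
    using cyclic_prod_append[of "[1]" "replicate k 1 @ xs"] by simp
  also have "\<dots> \<cong> cyclic_prod [1] \<times>\<times> cyclic_prod xs"
    using Suc by (intro DirProd_iso_cong) auto
  also note \<open>cyclic_prod [1] \<times>\<times> cyclic_prod xs \<cong> cyclic_prod xs\<close>
  finally show ?case .
qed simp

text \<open>Allows the list of invariant factors to be padded to any greater length.\<close>

lemma Zmod_append_ones: "Zmod (xs @ replicate k 1) = Zmod xs"
  using Zmod_swap[of xs "replicate k 1"] Zmod_eqI[OF cyclic_prod_ones[of k xs]] by simp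

lemma fin_ab_group_cyclic_prod: "\<forall>n\<in>set ns. n > 0 \<Longrightarrow> fin_ab_group (cyclic_prod ns)"
  by (simp add: fin_ab_group_def finite_cyclic_prod)

lemma fin_ab_group_imp_group: "fin_ab_group G \<Longrightarrow> group G"
  by (simp add: fin_ab_group_def comm_group_def)

lemma fin_ab_group_DirProd:
  assumes "fin_ab_group G" "fin_ab_group H"
  shows "fin_ab_group (G \<times>\<times> H)"
proof -
  interpret G: comm_group G using assms(1) by (simp add: fin_ab_group_def)
  interpret H: comm_group H using assms(2) by (simp add: fin_ab_group_def)
  have "comm_group (G \<times>\<times> H)"
    by (rule group.group_comm_groupI[OF DirProd_group[OF G.is_group H.is_group]])
       (auto simp: G.m_comm H.m_comm)
  then show ?thesis
    using assms by (simp add: fin_ab_group_def)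
qed

lemma Zmod_append_in_class_times:
  assumes "Zmod xs \<in> \<A>" "Zmod ys \<in> \<B>" "\<forall>n\<in>set xs. n > 0" "\<forall>n\<in>set ys. n > 0"
  shows "Zmod (xs @ ys) \<in> \<A> \<times>\<^sub>G \<B>"
proof -
  obtain H :: "nat monoid" where H: "fin_ab_group H" "cyclic_prod xs \<cong> H"
    using finite_group_nat_copy[OF fin_ab_group_cyclic_prod[OF assms(3)]] by blast
  obtain K :: "nat monoid" where K: "fin_ab_group K" "cyclic_prod ys \<cong> K"
    using finite_group_nat_copy[OF fin_ab_group_cyclic_prod[OF assms(4)]] by blast
  note g = fin_ab_group_imp_group[OF H(1)] fin_ab_group_imp_group[OF K(1)]
  have "cyclic_prod (xs @ ys) \<cong> cyclic_prod xs \<times>\<times> cyclic_prod ys"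
    by (rule cyclic_prod_append)
  also have "\<dots> \<cong> H \<times>\<times> K"
    using H(2) K(2) by (intro DirProd_iso_cong) simp_all
  finally have "Zmod (xs @ ys) = iso_class (H \<times>\<times> K)"
    unfolding Zmod_cyclic_prod using g by (intro iso_class_eqI) (simp_all add: DirProd_group)
  moreover have "iso_class H = Zmod xs" "iso_class K = Zmod ys"
    unfolding Zmod_cyclic_prod
    using iso_class_eqI[OF group_cyclic_prod g(1) H(2)] iso_class_eqI[OF group_cyclic_prod g(2) K(2)]
    by simp_all
  ultimately show ?thesis
    using H(1) K(1) assms(1,2) unfolding class_times_def
    by (intro CollectI exI[where x = H] exI[where x = K]) simp
qed

text \<open>The inclusion of \<open>H\<close> and the projection to \<open>K\<close> form a split
  exact sequence around \<open>H \<times>\<times> K\<close>; both maps are transported along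
  \<open>f\<close> to a copy \<open>G\<close> on natural numbers.\<close>

lemma class_times_subset_class_ext: "\<A> \<times>\<^sub>G \<B> \<subseteq> \<A> \<bullet>\<^sub>G \<B>"
proof
  fix C assume "C \<in> \<A> \<times>\<^sub>G \<B>"
  then obtain H K :: "nat monoid" where C: "C = iso_class (H \<times>\<times> K)" "fin_ab_group H" "fin_ab_group K"
    "iso_class H \<in> \<A>" "iso_class K \<in> \<B>"
    unfolding class_times_def by blast
  interpret H: group H using C(2) by (rule fin_ab_group_imp_group)
  interpret K: group K using C(3) by (rule fin_ab_group_imp_group)
  obtain G :: "nat monoid" where G: "fin_ab_group G" "H \<times>\<times> K \<cong> G"
    using finite_group_nat_copy[OF fin_ab_group_DirProd[OF C(2,3)]] by blast
  interpret G: group G using G(1) by (rule fin_ab_group_imp_group)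
  interpret HK: group "H \<times>\<times> K" by (rule DirProd_group) unfold_locales
  obtain f where f: "f \<in> iso (H \<times>\<times> K) G"
    using G(2) by (auto simp: is_iso_def)
  let ?g = "inv_into (carrier (H \<times>\<times> K)) f"
  have f': "f \<in> hom (H \<times>\<times> K) G" "bij_betw f (carrier (H \<times>\<times> K)) (carrier G)"
    using f by (simp_all add: iso_def)
  have g: "?g \<in> hom G (H \<times>\<times> K)" "bij_betw ?g (carrier G) (carrier (H \<times>\<times> K))"
    using HK.iso_set_sym[OF f] by (simp_all add: iso_def)
  have gf: "?g (f z) = z" if "z \<in> carrier (H \<times>\<times> K)" for z
    using bij_betw_inv_into_left[OF f'(2) that] .
  have fg: "f (?g z) = z" if "z \<in> carrier G" for z
    using bij_betw_inv_into_right[OF f'(2) that] .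
  have gc: "?g z \<in> carrier (H \<times>\<times> K)" if "z \<in> carrier G" for z
    using bij_betwE[OF g(2)] that by blast
  have fc: "f z \<in> carrier G" if "z \<in> carrier (H \<times>\<times> K)" for z
    using bij_betwE[OF f'(2)] that by blast
  let ?i = "\<lambda>h. f (h, \<one>\<^bsub>K\<^esub>)" and ?p = "\<lambda>x. snd (?g x)"
  have ihom: "?i \<in> hom H G"
    by (rule homI) (use fc hom_mult[OF f'(1)] in \<open>auto simp flip: hom_mult[OF f'(1)]\<close>)
  have phom: "?p \<in> hom G K"
  proof (rule homI)
    fix x y assume xy: "x \<in> carrier G" "y \<in> carrier G"
    show "?p (x \<otimes>\<^bsub>G\<^esub> y) = ?p x \<otimes>\<^bsub>K\<^esub> ?p y"
      using hom_mult[OF g(1) xy] by (simp add: mult_DirProd')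
  qed (use gc in \<open>auto simp: mem_Times_iff\<close>)
  have inj: "inj_on ?i (carrier H)"
  proof (rule inj_onI)
    fix x y assume "x \<in> carrier H" "y \<in> carrier H" "f (x, \<one>\<^bsub>K\<^esub>) = f (y, \<one>\<^bsub>K\<^esub>)"
    then have "(x, \<one>\<^bsub>K\<^esub>) = (y, \<one>\<^bsub>K\<^esub>)"
      using gf[of "(x, \<one>\<^bsub>K\<^esub>)"] gf[of "(y, \<one>\<^bsub>K\<^esub>)"] by simp
    then show "x = y"
      by simp
  qed
  have surj: "carrier K \<subseteq> ?p ` carrier G"
  proof
    fix k assume "k \<in> carrier K"
    then have "f (\<one>\<^bsub>H\<^esub>, k) \<in> carrier G" "?p (f (\<one>\<^bsub>H\<^esub>, k)) = k"
      using fc[of "(\<one>\<^bsub>H\<^esub>, k)"] gf[of "(\<one>\<^bsub>H\<^esub>, k)"] by simp_all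
    then show "k \<in> ?p ` carrier G"
      by (metis imageI)
  qed
  have ker: "kernel G K ?p = ?i ` carrier H"
  proof
    show "kernel G K ?p \<subseteq> ?i ` carrier H"
    proof
      fix x assume x: "x \<in> kernel G K ?p"
      then have xG: "x \<in> carrier G" and "?p x = \<one>\<^bsub>K\<^esub>"
        by (simp_all add: kernel_def)
      then have "?g x = (fst (?g x), \<one>\<^bsub>K\<^esub>)"
        by (metis prod.collapse)
      then have "x = ?i (fst (?g x))"
        using fg[OF xG] by simp
      moreover have "fst (?g x) \<in> carrier H"
        using gc[OF xG] by (auto simp: mem_Times_iff)
      ultimately show "x \<in> ?i ` carrier H"
        by (rule image_eqI)
    qed
    show "?i ` carrier H \<subseteq> kernel G K ?p"
      using fc gf by (auto simp: kernel_def)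
  qed
  have ses: "short_exact_sequence K G H ?p ?i"
    unfolding short_exact_sequence_iff
    using ihom phom inj surj ker bij_betwE[OF g(2)]
    by (auto simp: epi_iff_subset mon_def group_hom_def group_hom_axioms_def H.is_group K.is_group G.is_group)
  have "\<exists>H K p i. fin_ab_group H \<and> fin_ab_group K \<and> iso_class H \<in> \<A> \<and> iso_class K \<in> \<B> \<and>
      short_exact_sequence K G H p i"
    by (rule exI[where x = H], rule exI[where x = K], rule exI[where x = ?p], rule exI[where x = ?i])
      (intro conjI C(2-5) ses)
  moreover have "C = iso_class G"
    unfolding C(1) by (rule iso_class_eqI[OF HK.is_group G.is_group G(2)])
  ultimately show "C \<in> \<A> \<bullet>\<^sub>G \<B>"
    using G(1) unfolding class_ext_def by simp metis
qed

text \<open>An entry \<open>0\<close> of \<open>T\<close> stands for a cyclic factor of arbitrary order.\<close>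

definition torsion_bounded :: "nat list \<Rightarrow> ('a, 'b) monoid_scheme \<Rightarrow> bool" where
  "torsion_bounded T G \<longleftrightarrow> (\<forall>n>0. torsion_card G n \<le> (\<Prod>m\<leftarrow>T. gcd n m))"

lemma torsion_bounded_iso:
  assumes "torsion_bounded T G" "group G" "group H" "G \<cong> H"
  shows "torsion_bounded T H"
  using assms(1) torsion_card_iso[OF assms(2-4)] by (simp add: torsion_bounded_def)

lemma torsion_bounded_DirProd:
  assumes "torsion_bounded S G" "torsion_bounded T H"
  shows "torsion_bounded (S @ T) (G \<times>\<times> H)"
  using assms by (simp add: torsion_bounded_def torsion_card_DirProd mult_mono)

lemma torsion_bounded_extension:
  assumes "fin_ab_group G" "fin_ab_group H" "fin_ab_group K" "short_exact_sequence K G H p i"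
    and "torsion_bounded S H" "torsion_bounded T K"
  shows "torsion_bounded (S @ T) G"
  unfolding torsion_bounded_def
proof (intro allI impI)
  fix n :: nat assume "n > 0"
  then have "torsion_card H n * torsion_card K n \<le> (\<Prod>m\<leftarrow>S. gcd n m) * (\<Prod>m\<leftarrow>T. gcd n m)"
    using assms(5,6) by (intro mult_mono) (simp_all add: torsion_bounded_def)
  then show "torsion_card G n \<le> (\<Prod>m\<leftarrow>S @ T. gcd n m)"
    using torsion_card_extension[OF assms(1-4), of n] by simp
qed

text \<open>Termwise, \<open>gcd n m\<close> divides \<open>gcd n t\<close>. Positivity of
  \<open>n\<close> keeps an entry 0 of \<open>T\<close> from contributing
  \<open>gcd 0 0 = 0\<close>.\<close>

lemma prod_list_gcd_mono:
  assumes "list_all2 (\<lambda>m t. m dvd t) ms T" "n > 0"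
  shows "(\<Prod>m\<leftarrow>ms. gcd n m) \<le> (\<Prod>m\<leftarrow>T. gcd n m :: nat)"
  using assms(1)
proof (induction rule: list_all2_induct)
  case (Cons m ms t T)
  have "gcd n m \<le> gcd n t"
    using Cons(1) assms(2) by (intro dvd_imp_le gcd_mono) auto
  then show ?case
    using Cons by (simp add: mult_mono)
qed simp

text \<open>Every \<open>m\<close> divides 0, so a single list \<open>T\<close> bounds an infinite
  family with free parameters.\<close>

lemma torsion_bounded_Zmod:
  fixes K :: "nat monoid"
  assumes "iso_class K = Zmod ms" "group K" "\<forall>m\<in>set ms. m > 0" "list_all2 (\<lambda>m t. m dvd t) ms T"
  shows "torsion_bounded T K"
proof (rule torsion_bounded_iso)
  show "torsion_bounded T (cyclic_prod ms)"
    using assms(3,4) by (simp add: torsion_bounded_def torsion_card_cyclic_prod prod_list_gcd_mono)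
  show "cyclic_prod ms \<cong> K"
    using assms(1,2) by (intro iso_class_eqD) (simp_all add: Zmod_cyclic_prod)
qed (use assms(2) in auto)

section \<open>Torsion bounds for the listed families\<close>

definition A1_bounds :: "nat list set" where
  "A1_bounds = {[0], [2, 2]}"

text \<open>In \<open>[0, 2, 2]\<close> the factor \<open>2 * k\<close> is recorded as arbitrary;
  its evenness is recovered from the counts when the splitting needs it.\<close>

definition A2_bounds :: "nat list set" where
  "A2_bounds = {[0, 0], [0, 2, 2], [4, 4, 2], [3, 3, 3], [2, 2, 2, 2]}"

definition B3_bounds :: "nat list set" where
  "B3_bounds = {S @ T | S T. S \<in> A1_bounds \<and> T \<in> A2_bounds} \<union>
     {[4, 4, 4, 4], [8, 8, 4, 2], [6, 6, 3, 3], [6, 6, 6, 2]}"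

lemma A1_torsion_bounded:
  fixes H :: "nat monoid"
  assumes "iso_class H \<in> A1_list" "group H"
  shows "\<exists>T\<in>A1_bounds. torsion_bounded T H"
  using assms(1) unfolding A1_list_def A1_bounds_def
  by (auto dest!: torsion_bounded_Zmod[OF _ assms(2), of "[_]" "[0]"]
      torsion_bounded_Zmod[OF _ assms(2), of "[2, 2]" "[2, 2]"])

lemma A2_torsion_bounded:
  fixes H :: "nat monoid"
  assumes "iso_class H \<in> A2_list" "group H"
  shows "\<exists>T\<in>A2_bounds. torsion_bounded T H"
proof -
  note * = torsion_bounded_Zmod[OF _ assms(2)]
  from assms(1) consider k m where "k \<ge> 1" "m \<ge> 1" "iso_class H = Zmod [k, m]"
    | k where "k \<ge> 1" "iso_class H = Zmod [2 * k, 2, 2]"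
    | "iso_class H = Zmod [4, 4, 2]" | "iso_class H = Zmod [3, 3, 3]" | "iso_class H = Zmod [2, 2, 2, 2]"
    unfolding A2_list_def by blast
  then show ?thesis
  proof cases
    case 1
    then have "torsion_bounded [0, 0] H"
      by (intro *) auto
    then show ?thesis
      by (auto simp: A2_bounds_def)
  next
    case 2
    then have "torsion_bounded [0, 2, 2] H"
      by (intro *) auto
    then show ?thesis
      by (auto simp: A2_bounds_def)
  qed (force simp: A2_bounds_def dest: *[where T = "[4, 4, 2]"] *[where T = "[3, 3, 3]"] *[where T = "[2, 2, 2, 2]"])+
qed

lemma B3_torsion_bounded:
  fixes K :: "nat monoid"
  assumes "iso_class K \<in> B3' A1_list A2_list" "group K"
  shows "\<exists>T\<in>B3_bounds. torsion_bounded T K"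
proof -
  note * = torsion_bounded_Zmod[OF _ assms(2)]
  from assms(1) consider "iso_class K \<in> A1_list \<times>\<^sub>G A2_list"
    | "iso_class K = Zmod [4, 4, 4, 4]" | "iso_class K = Zmod [8, 8, 4, 2]"
    | "iso_class K = Zmod [6, 6, 3, 3]" | "iso_class K = Zmod [6, 6, 6, 2]"
    unfolding B3'_def by blast
  then show ?thesis
  proof cases
    case 1
    then obtain H1 H2 :: "nat monoid" where H: "iso_class K = iso_class (H1 \<times>\<times> H2)"
        "fin_ab_group H1" "fin_ab_group H2" "iso_class H1 \<in> A1_list" "iso_class H2 \<in> A2_list"
      unfolding class_times_def by blast
    note g = fin_ab_group_imp_group[OF H(2)] fin_ab_group_imp_group[OF H(3)]
    obtain S T where ST: "S \<in> A1_bounds" "torsion_bounded S H1" "T \<in> A2_bounds" "torsion_bounded T H2"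
      using A1_torsion_bounded[OF H(4) g(1)] A2_torsion_bounded[OF H(5) g(2)] by blast
    have "torsion_bounded (S @ T) K"
      using torsion_bounded_DirProd[OF ST(2,4)] DirProd_group[OF g] assms(2)
        iso_class_eqD[OF H(1)[symmetric] assms(2)]
      by (rule torsion_bounded_iso)
    then show ?thesis
      using ST by (auto simp: B3_bounds_def)
  next
    case 2
    then have "torsion_bounded [4, 4, 4, 4] K"
      by (intro *) auto
    then show ?thesis
      by (rule bexI) (simp add: B3_bounds_def)
  next
    case 3
    then have "torsion_bounded [8, 8, 4, 2] K"
      by (intro *) auto
    then show ?thesis
      by (rule bexI) (simp add: B3_bounds_def)
  next
    case 4
    then have "torsion_bounded [6, 6, 3, 3] K"
      by (intro *) auto
    then show ?thesis
      by (rule bexI) (simp add: B3_bounds_def)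
  next
    case 5
    then have "torsion_bounded [6, 6, 6, 2] K"
      by (intro *) auto
    then show ?thesis
      by (rule bexI) (simp add: B3_bounds_def)
  qed
qed

lemma class_ext_torsion_bounded:
  assumes "C \<in> \<A> \<bullet>\<^sub>G \<B>"
    and "\<And>H :: nat monoid. iso_class H \<in> \<A> \<Longrightarrow> group H \<Longrightarrow> \<exists>T\<in>P. torsion_bounded T H"
    and "\<And>H :: nat monoid. iso_class H \<in> \<B> \<Longrightarrow> group H \<Longrightarrow> \<exists>T\<in>Q. torsion_bounded T H"
  obtains G :: "nat monoid" and S T where "C = iso_class G" "fin_ab_group G" "S \<in> P" "T \<in> Q"
    "torsion_bounded (S @ T) G"
proof -
  obtain G H K :: "nat monoid" and p i where G: "C = iso_class G" "fin_ab_group G" "fin_ab_group H"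
      "fin_ab_group K" "short_exact_sequence K G H p i"
    and HK: "iso_class H \<in> \<A>" "iso_class K \<in> \<B>"
    using assms(1) unfolding class_ext_def by blast
  obtain S T where "S \<in> P" "torsion_bounded S H" "T \<in> Q" "torsion_bounded T K"
    using assms(2)[OF HK(1) fin_ab_group_imp_group[OF G(3)]]
      assms(3)[OF HK(2) fin_ab_group_imp_group[OF G(4)]] by blast
  then show ?thesis
    using that G(1,2) torsion_bounded_extension[OF G(2-5)] by blast
qed

section \<open>Counting invariant factors divisible by prime powers\<close>

text \<open>The exponent is the smaller of \<open>t\<close> and the multiplicity of \<open>p\<close>
  in \<open>m\<close>, or \<open>t\<close> if \<open>m = 0\<close>. Written level by level, it can
  be summed over a list of factors and turns into \<open>dvd_count\<close>.\<close>

lemma gcd_prime_power: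
  assumes "Factorial_Ring.prime (p::nat)"
  shows "gcd (p ^ t) m = p ^ (\<Sum>i=1..t. of_bool (p ^ i dvd m))"
proof (induction t)
  case (Suc t)
  show ?case
  proof (cases "p ^ Suc t dvd m")
    case True
    have "(\<Sum>i=1..Suc t. of_bool (p ^ i dvd m)) = (\<Sum>i=1..Suc t. 1 :: nat)"
      by (intro sum.cong) (use power_le_dvd[OF True] in auto)
    then show ?thesis
      using True by (simp add: gcd_nat.absorb1)
  next
    case False
    obtain j where j: "j \<le> Suc t" "gcd (p ^ Suc t) m = p ^ j"
      using divides_primepow_nat[OF assms] by (metis gcd_dvd1)
    have "j \<noteq> Suc t"
      using False j(2) by (metis gcd_dvd2)
    then have "p ^ j dvd p ^ t"
      using j(1) by (intro le_imp_power_dvd) simp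
    then have "gcd (p ^ Suc t) m = gcd (p ^ t) m"
      using j(2) by (metis dvd_antisym dvd_refl gcd_dvd2 gcd_greatest gcd_mono le_imp_power_dvd le_SucI order_refl)
    then show ?thesis
      using False Suc by simp
  qed
qed simp

definition dvd_count :: "nat list \<Rightarrow> nat \<Rightarrow> nat" where
  "dvd_count ms q = length (filter ((dvd) q) ms)"

lemma dvd_count_simps [simp]:
  "dvd_count [] q = 0"
  "dvd_count (m # ms) q = of_bool (q dvd m) + dvd_count ms q"
  by (simp_all add: dvd_count_def)

lemma prod_list_gcd_prime_power:
  assumes "Factorial_Ring.prime p"
  shows "(\<Prod>m\<leftarrow>ms. gcd (p ^ t) m) = p ^ (\<Sum>i=1..t. dvd_count ms (p ^ i))"
  by (induction ms) (simp_all add: gcd_prime_power[OF assms] sum.distrib power_add)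

text \<open>Each factor divides the earlier ones, so the multiples of \<open>q\<close> form an
  initial segment. Beyond the end the default 1 stands for trivial factors, which only
  \<open>q = 1\<close> divides.\<close>

lemma dvd_nth_iff_less_dvd_count:
  assumes "sorted_wrt (\<lambda>a b. b dvd a) ns" "q \<noteq> 1"
  shows "q dvd nth_default 1 ns i \<longleftrightarrow> i < dvd_count ns q"
  using assms(1)
proof (induction ns arbitrary: i)
  case Nil
  then show ?case
    using assms(2) by simp
next
  case (Cons a ns)
  show ?case
  proof (cases "q dvd a")
    case True
    then show ?thesis
      using Cons by (cases i) (simp_all add: nth_default_Cons)
  next
    case False
    then have "\<forall>b\<in>set ns. \<not> q dvd b"
      using Cons.prems by (auto dest: dvd_trans)
    then have 0: "dvd_count (a # ns) q = 0"
      using False by (simp add: dvd_count_def)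
    have "\<not> q dvd nth_default 1 ns j" for j
      using Cons.IH[of j] Cons.prems 0 by simp
    then show ?thesis
      using False 0 by (cases i) (simp_all add: nth_default_Cons)
  qed
qed

lemma eq_prime_power_prod_2_3:
  fixes m :: nat
  assumes "m > 0" "\<And>p. Factorial_Ring.prime p \<Longrightarrow> p \<ge> 5 \<Longrightarrow> \<not> p dvd m"
    "2 ^ a dvd m" "\<not> 2 ^ Suc a dvd m" "3 ^ b dvd m" "\<not> 3 ^ Suc b dvd m"
  shows "m = 2 ^ a * 3 ^ b"
proof -
  have "coprime (2 ^ a) (3 ^ b :: nat)"
    by (simp add: coprime_power_left_iff coprime_power_right_iff)
  then have "2 ^ a * 3 ^ b dvd m"
    by (rule divides_mult[OF assms(3,5)])
  then obtain r where r: "m = 2 ^ a * 3 ^ b * r"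
    by blast
  have "r = 1"
  proof (rule ccontr)
    assume "r \<noteq> 1"
    then obtain p where p: "Factorial_Ring.prime p" "p dvd r"
      using prime_factor_nat by blast
    then have "p dvd m"
      using r by simp
    then have "p < 5"
      using assms(2) p(1) by (meson not_less)
    moreover have "p \<noteq> 2"
      using p(2) r assms(4) by (auto elim!: dvdE)
    moreover have "p \<noteq> 3"
      using p(2) r assms(6) by (auto elim!: dvdE)
    moreover have "p \<noteq> 4"
      using p(1) primes_dvd_imp_eq[OF two_is_prime_nat p(1)] by auto
    ultimately show False
      using prime_ge_2_nat[OF p(1)] by linarith
  qed
  then show ?thesis
    using r by simp
qed

section \<open>From bounds on the counts to direct products\<close>

abbreviation (input) split_classes :: "nat monoid set set" where
  "split_classes \<equiv> (A1_list \<times>\<^sub>G B3' A1_list A2_list) \<union> (A2_list \<times>\<^sub>G A2_list)"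

lemma Zmod_in_A1_list:
  "k > 0 \<Longrightarrow> Zmod [k] \<in> A1_list" "Zmod [2, 2] \<in> A1_list"
  unfolding A1_list_def using Suc_leI[of 0] by auto

lemma Zmod_in_A2_list:
  "Zmod [4, 4, 2] \<in> A2_list" "Zmod [3, 3, 3] \<in> A2_list" "Zmod [2, 2, 2, 2] \<in> A2_list"
  "k > 0 \<Longrightarrow> m > 0 \<Longrightarrow> Zmod [k, m] \<in> A2_list"
  "k > 0 \<Longrightarrow> 2 dvd k \<Longrightarrow> Zmod [k, 2, 2] \<in> A2_list"
proof -
  show "Zmod [k, m] \<in> A2_list" if "k > 0" "m > 0"
  proof -
    have "\<exists>k' m'. Zmod [k, m] = Zmod [k', m'] \<and> k' \<ge> 1 \<and> m' \<ge> 1"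
      using that by (intro exI[where x = k] exI[where x = m]) simp
    then show ?thesis
      unfolding A2_list_def by simp
  qed
  show "Zmod [k, 2, 2] \<in> A2_list" if "k > 0" "2 dvd k"
  proof -
    have "\<exists>k'. Zmod [k, 2, 2] = Zmod [2 * k', 2, 2] \<and> k' \<ge> 1"
      using that by (intro exI[where x = "k div 2"]) auto
    then show ?thesis
      unfolding A2_list_def by simp
  qed
qed (simp_all add: A2_list_def)

text \<open>Invariant factors are listed with multiples first, so the part from
  \<open>A1_list\<close> may stand last, as in \<open>[4, 4, 2] @ [2, 2]\<close>. The second form
  serves such lists.\<close>

lemma Zmod_in_B3':
  assumes "Zmod ys \<in> A1_list" "Zmod zs \<in> A2_list" "\<forall>m\<in>set (ys @ zs). m > 0"
  shows "Zmod (ys @ zs) \<in> B3' A1_list A2_list" "Zmod (zs @ ys) \<in> B3' A1_list A2_list"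
proof -
  show "Zmod (ys @ zs) \<in> B3' A1_list A2_list"
    unfolding B3'_def using assms by (intro UnI1 Zmod_append_in_class_times) simp_all
  then show "Zmod (zs @ ys) \<in> B3' A1_list A2_list"
    by (simp only: Zmod_swap)
qed

lemma Zmod_in_B3'_sporadic:
  "Zmod [4, 4, 4, 4] \<in> B3' A1_list A2_list" "Zmod [8, 8, 4, 2] \<in> B3' A1_list A2_list"
  "Zmod [6, 6, 3, 3] \<in> B3' A1_list A2_list" "Zmod [6, 6, 6, 2] \<in> B3' A1_list A2_list"
  by (simp_all add: B3'_def)

lemma split_classes_I1:
  assumes "Zmod xs \<in> A1_list" "Zmod ys \<in> B3' A1_list A2_list" "\<forall>m\<in>set (xs @ ys). m > 0"
  shows "Zmod (xs @ ys) \<in> split_classes" "Zmod (ys @ xs) \<in> split_classes"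
proof -
  show "Zmod (xs @ ys) \<in> split_classes"
    using assms by (intro UnI1 Zmod_append_in_class_times) simp_all
  then show "Zmod (ys @ xs) \<in> split_classes"
    by (simp only: Zmod_swap)
qed

lemma split_classes_I2:
  assumes "Zmod xs \<in> A2_list" "Zmod ys \<in> A2_list" "\<forall>m\<in>set (xs @ ys). m > 0"
  shows "Zmod (xs @ ys) \<in> split_classes"
  using assms by (intro UnI2 Zmod_append_in_class_times) simp_all

text \<open>The factors form an infinite sequence ending in ones, which avoids distinguishing their
  number. If \<open>n r = 1\<close>, then \<open>dvd_iff\<close> makes all later terms 1, so any
  such \<open>r\<close> may serve as the length.\<close>

locale invariant_factors =
  fixes n c :: "nat \<Rightarrow> nat" and C :: "nat monoid set"
  assumes pos: "n i > 0"
    and dvd_iff: "q \<noteq> 1 \<Longrightarrow> q dvd n i \<longleftrightarrow> i < c q"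
    and class_eq: "n r = 1 \<Longrightarrow> C = Zmod (map n [0..<r])"
begin

text \<open>Equivalently, no factor with index at least \<open>k\<close> has a prime divisor other
  than 2 and 3.\<close>

definition rank_le :: "nat \<Rightarrow> bool" where
  "rank_le k \<longleftrightarrow> (\<forall>p. Factorial_Ring.prime p \<longrightarrow> p \<ge> 5 \<longrightarrow> c p \<le> k)"

lemma rank_le_mono: "rank_le j \<Longrightarrow> j \<le> k \<Longrightarrow> rank_le k"
  unfolding rank_le_def by (meson order_trans)

lemma count_antimono: "q dvd r \<Longrightarrow> q \<noteq> 1 \<Longrightarrow> r \<noteq> 1 \<Longrightarrow> c r \<le> c q"
  using dvd_iff by (meson dvd_trans leI less_irrefl)

lemma count_le: "c 4 \<le> c 2" "c 8 \<le> c 4" "c 16 \<le> c 8" "c 9 \<le> c 3"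
  by (simp_all add: count_antimono)

lemma factor_eqI:
  assumes "rank_le k" "k \<le> i" "2 ^ a dvd n i" "\<not> 2 ^ Suc a dvd n i" "3 ^ b dvd n i" "\<not> 3 ^ Suc b dvd n i"
  shows "n i = 2 ^ a * 3 ^ b"
proof (rule eq_prime_power_prod_2_3)
  show "\<not> p dvd n i" if "Factorial_Ring.prime p" "p \<ge> 5" for p
  proof -
    have "c p \<le> i"
      using assms(1,2) that unfolding rank_le_def by (meson order_trans)
    then show ?thesis
      using dvd_iff[of p i] that(2) by auto
  qed
qed (use assms pos in auto)

text \<open>The position of \<open>i\<close> among the counts gives the exact multiplicities of 2
  and 3 in \<open>n i\<close>, and \<open>k \<le> i\<close> excludes other primes. The six values
  are those that occur among the determined factors.\<close>

lemma factor_eq: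
  assumes "rank_le k" "k \<le> i"
  shows factor_eq_1: "c 2 \<le> i \<Longrightarrow> c 3 \<le> i \<Longrightarrow> n i = 1"
    and factor_eq_2: "i < c 2 \<Longrightarrow> c 4 \<le> i \<Longrightarrow> c 3 \<le> i \<Longrightarrow> n i = 2"
    and factor_eq_4: "i < c 4 \<Longrightarrow> c 8 \<le> i \<Longrightarrow> c 3 \<le> i \<Longrightarrow> n i = 4"
    and factor_eq_8: "i < c 8 \<Longrightarrow> c 16 \<le> i \<Longrightarrow> c 3 \<le> i \<Longrightarrow> n i = 8"
    and factor_eq_3: "c 2 \<le> i \<Longrightarrow> i < c 3 \<Longrightarrow> c 9 \<le> i \<Longrightarrow> n i = 3"
    and factor_eq_6: "i < c 2 \<Longrightarrow> c 4 \<le> i \<Longrightarrow> i < c 3 \<Longrightarrow> c 9 \<le> i \<Longrightarrow> n i = 6"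
  using factor_eqI[OF assms, of 0 0] factor_eqI[OF assms, of 1 0] factor_eqI[OF assms, of 2 0]
    factor_eqI[OF assms, of 3 0] factor_eqI[OF assms, of 0 1] factor_eqI[OF assms, of 1 1]
    dvd_iff[of 2 i] dvd_iff[of 4 i] dvd_iff[of 8 i] dvd_iff[of 16 i] dvd_iff[of 3 i] dvd_iff[of 9 i]
  by (simp_all add: not_less)

lemma upt_unfold:
  "[0..<4] = [0, 1, 2, 3]" "[0..<5] = [0, 1, 2, 3, 4]" "[0..<6] = [0, 1, 2, 3, 4, 5]"
  "[0..<7] = [0, 1, 2, 3, 4, 5, 6]" "[0..<8] = [0, 1, 2, 3, 4, 5, 6, 7]"
  by (simp_all add: upt_conv_Cons)

text \<open>In the names below a prime is followed by the bounds for the partial sums of the counts at its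
  powers: \<open>split_of_2_5_8\<close> assumes \<open>c 2 \<le> 5\<close> and \<open>c 2 + c 4 \<le> 8\<close>. If none of the earlier, smaller bounds
  holds, then the counts are so rigid that all but the largest invariant factors are determined.\<close>

lemma split_of_rank_le_4:
  assumes "c 2 \<le> 4" "c 3 \<le> 4" "rank_le 4"
  shows "C \<in> split_classes"
proof -
  have "n 4 = 1"
    by (rule factor_eq_1[OF assms(3)]) (use assms in simp_all)
  then have "C = Zmod ([n 0, n 1] @ [n 2, n 3])"
    using class_eq[of 4] by (simp add: upt_unfold)
  then show ?thesis
    using split_classes_I2[OF Zmod_in_A2_list(4)[OF pos pos] Zmod_in_A2_list(4)[OF pos pos]] pos by simp
qed

lemma split_of_2_5_8:
  assumes "c 2 \<le> 5" "c 2 + c 4 \<le> 8" "c 3 \<le> 3" "rank_le 3"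
  shows "C \<in> split_classes"
proof -
  consider "c 2 \<le> 4" | "c 2 = 5 \<and> c 4 \<le> 3"
    using assms count_le by linarith
  then show ?thesis
  proof cases
    case 1
    then show ?thesis
      by (intro split_of_rank_le_4 rank_le_mono[OF assms(4)]) (use assms count_le in linarith)+
  next
    case 2
    note h = assms(1-3) 2 count_le
    have e2: "n 3 = 2" "n 4 = 2"
      by (rule factor_eq_2[OF assms(4)]; use h in linarith)+
    have e1: "n 5 = 1"
      by (rule factor_eq_1[OF assms(4)]; use h in linarith)+
    \<comment> \<open>Membership of \<open>[n 2, 2, 2]\<close> in \<open>A2_list\<close> needs an
      even first factor; here 2 is below \<open>c 2 = 5\<close>.\<close>
    have even: "2 dvd n 2"
      using h by (simp add: dvd_iff)
    have "C = Zmod ([n 0] @ [n 1] @ [n 2, 2, 2])"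
      using class_eq[of 5] by (simp add: upt_unfold e2 e1 del: One_nat_def)
    then show ?thesis
      using split_classes_I1(1)[OF Zmod_in_A1_list(1)[OF pos] Zmod_in_B3'(1)[OF Zmod_in_A1_list(1)[OF pos] Zmod_in_A2_list(5)[OF pos even]]] pos by simp
  qed
qed

text \<open>These are the bounds of \<open>[0, 0] @ [4, 4, 2]\<close>; in the extreme case that very
  pattern appears below two free factors.\<close>

lemma split_of_2_5_9_11:
  assumes "c 2 \<le> 5" "c 2 + c 4 \<le> 9" "c 2 + c 4 + c 8 \<le> 11" "c 3 \<le> 2" "rank_le 2"
  shows "C \<in> split_classes"
proof -
  consider "c 2 + c 4 \<le> 8" | "c 2 = 5 \<and> c 4 = 4 \<and> c 8 \<le> 2"
    using assms count_le by linarith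
  then show ?thesis
  proof cases
    case 1
    then show ?thesis
      by (intro split_of_2_5_8 rank_le_mono[OF assms(5)]) (use assms count_le in linarith)+
  next
    case 2
    note h = assms(1-4) 2 count_le
    have e4: "n 2 = 4" "n 3 = 4"
      by (rule factor_eq_4[OF assms(5)]; use h in linarith)+
    have e2: "n 4 = 2"
      by (rule factor_eq_2[OF assms(5)]; use h in linarith)+
    have e1: "n 5 = 1"
      by (rule factor_eq_1[OF assms(5)]; use h in linarith)+
    have "C = Zmod ([n 0] @ [n 1] @ [4, 4, 2])"
      using class_eq[of 5] by (simp add: upt_unfold e4 e2 e1 del: One_nat_def)
    then show ?thesis
      using split_classes_I1(1)[OF Zmod_in_A1_list(1)[OF pos] Zmod_in_B3'(1)[OF Zmod_in_A1_list(1)[OF pos] Zmod_in_A2_list(1)]] pos by simp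
  qed
qed

lemma split_of_3_5_7:
  assumes "c 3 \<le> 5" "c 3 + c 9 \<le> 7" "c 2 \<le> 2" "rank_le 2"
  shows "C \<in> split_classes"
proof -
  consider "c 3 \<le> 4" | "c 3 = 5 \<and> c 9 \<le> 2"
    using assms count_le by linarith
  then show ?thesis
  proof cases
    case 1
    then show ?thesis
      by (intro split_of_rank_le_4 rank_le_mono[OF assms(4)]) (use assms count_le in linarith)+
  next
    case 2
    note h = assms(1-3) 2 count_le
    have e3: "n 2 = 3" "n 3 = 3" "n 4 = 3"
      by (rule factor_eq_3[OF assms(4)]; use h in linarith)+
    have e1: "n 5 = 1"
      by (rule factor_eq_1[OF assms(4)]; use h in linarith)+
    have "C = Zmod ([n 0] @ [n 1] @ [3, 3, 3])"
      using class_eq[of 5] by (simp add: upt_unfold e3 e1 del: One_nat_def)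
    then show ?thesis
      using split_classes_I1(1)[OF Zmod_in_A1_list(1)[OF pos] Zmod_in_B3'(1)[OF Zmod_in_A1_list(1)[OF pos] Zmod_in_A2_list(2)]] pos by simp
  qed
qed

text \<open>Both \<open>[0, 0] @ [2, 2, 2, 2]\<close> and \<open>[0, 2, 2] @ [0, 2, 2]\<close> have
  these bounds. One decomposition serves both.\<close>

lemma split_of_2_6_8:
  assumes "c 2 \<le> 6" "c 2 + c 4 \<le> 8" "c 3 \<le> 2" "rank_le 2"
  shows "C \<in> split_classes"
proof -
  consider "c 2 \<le> 5" | "c 2 = 6 \<and> c 4 \<le> 2"
    using assms count_le by linarith
  then show ?thesis
  proof cases
    case 1
    then show ?thesis
      by (intro split_of_2_5_8 rank_le_mono[OF assms(4)]) (use assms count_le in linarith)+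
  next
    case 2
    note h = assms(1-3) 2 count_le
    have e2: "n 2 = 2" "n 3 = 2" "n 4 = 2" "n 5 = 2"
      by (rule factor_eq_2[OF assms(4)]; use h in linarith)+
    have e1: "n 6 = 1"
      by (rule factor_eq_1[OF assms(4)]; use h in linarith)+
    have "C = Zmod ([n 0] @ [n 1] @ [2, 2, 2, 2])"
      using class_eq[of 6] by (simp add: upt_unfold e2 e1 del: One_nat_def)
    then show ?thesis
      using split_classes_I1(1)[OF Zmod_in_A1_list(1)[OF pos] Zmod_in_B3'(1)[OF Zmod_in_A1_list(1)[OF pos] Zmod_in_A2_list(3)]] pos by simp
  qed
qed

lemma split_of_2_6_9_10:
  assumes "c 2 \<le> 6" "c 2 + c 4 \<le> 9" "c 2 + c 4 + c 8 \<le> 10" "c 3 \<le> 1" "rank_le 1"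
  shows "C \<in> split_classes"
proof -
  consider "c 2 \<le> 5" | "c 2 + c 4 \<le> 8" | "c 2 = 6 \<and> c 4 = 3 \<and> c 8 \<le> 1"
    using assms count_le by linarith
  then show ?thesis
  proof cases
    case 1
    then show ?thesis
      by (intro split_of_2_5_9_11 rank_le_mono[OF assms(5)]) (use assms count_le in linarith)+
  next
    case 2
    then show ?thesis
      by (intro split_of_2_6_8 rank_le_mono[OF assms(5)]) (use assms count_le in linarith)+
  next
    case 3
    note h = assms(1-4) 3 count_le
    have e4: "n 1 = 4" "n 2 = 4"
      by (rule factor_eq_4[OF assms(5)]; use h in linarith)+
    have e2: "n 3 = 2" "n 4 = 2" "n 5 = 2"
      by (rule factor_eq_2[OF assms(5)]; use h in linarith)+
    have e1: "n 6 = 1"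
      by (rule factor_eq_1[OF assms(5)]; use h in linarith)+
    have "C = Zmod ([n 0] @ [4, 4, 2] @ [2, 2])"
      using class_eq[of 6] by (simp add: upt_unfold e4 e2 e1 del: One_nat_def)
    then show ?thesis
      using split_classes_I1(1)[OF Zmod_in_A1_list(1)[OF pos] Zmod_in_B3'(2)[OF Zmod_in_A1_list(2) Zmod_in_A2_list(1)]] pos by simp
  qed
qed

lemma split_of_2_7_8:
  assumes "c 2 \<le> 7" "c 2 + c 4 \<le> 8" "c 3 \<le> 1" "rank_le 1"
  shows "C \<in> split_classes"
proof -
  consider "c 2 \<le> 6" | "c 2 = 7 \<and> c 4 \<le> 1"
    using assms count_le by linarith
  then show ?thesis
  proof cases
    case 1
    then show ?thesis
      by (intro split_of_2_6_8 rank_le_mono[OF assms(4)]) (use assms count_le in linarith)+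
  next
    case 2
    note h = assms(1-3) 2 count_le
    have e2: "n 1 = 2" "n 2 = 2" "n 3 = 2" "n 4 = 2" "n 5 = 2" "n 6 = 2"
      by (rule factor_eq_2[OF assms(4)]; use h in linarith)+
    have e1: "n 7 = 1"
      by (rule factor_eq_1[OF assms(4)]; use h in linarith)+
    have "C = Zmod ([n 0] @ [2, 2] @ [2, 2, 2, 2])"
      using class_eq[of 7] by (simp add: upt_unfold e2 e1 del: One_nat_def)
    then show ?thesis
      using split_classes_I1(1)[OF Zmod_in_A1_list(1)[OF pos] Zmod_in_B3'(1)[OF Zmod_in_A1_list(2) Zmod_in_A2_list(3)]] pos by simp
  qed
qed

text \<open>A product of members of \<open>A1_list\<close> and \<open>A2_list\<close> has at most
  three factors divisible by 4. The four factors 4 below \<open>n 0\<close> therefore call for the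
  sporadic \<open>[4, 4, 4, 4]\<close>.\<close>

lemma split_of_2_5_10_11:
  assumes "c 2 \<le> 5" "c 2 + c 4 \<le> 10" "c 2 + c 4 + c 8 \<le> 11" "c 3 \<le> 1" "rank_le 1"
  shows "C \<in> split_classes"
proof -
  consider "c 2 + c 4 \<le> 9" | "c 2 = 5 \<and> c 4 = 5 \<and> c 8 \<le> 1"
    using assms count_le by linarith
  then show ?thesis
  proof cases
    case 1
    then show ?thesis
      by (intro split_of_2_5_9_11 rank_le_mono[OF assms(5)]) (use assms count_le in linarith)+
  next
    case 2
    note h = assms(1-4) 2 count_le
    have e4: "n 1 = 4" "n 2 = 4" "n 3 = 4" "n 4 = 4"
      by (rule factor_eq_4[OF assms(5)]; use h in linarith)+
    have e1: "n 5 = 1"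
      by (rule factor_eq_1[OF assms(5)]; use h in linarith)+
    have "C = Zmod ([n 0] @ [4, 4, 4, 4])"
      using class_eq[of 5] by (simp add: upt_unfold e4 e1 del: One_nat_def)
    then show ?thesis
      using split_classes_I1(1)[OF Zmod_in_A1_list(1)[OF pos] Zmod_in_B3'_sporadic(1)] pos by simp
  qed
qed

text \<open>The sum up to \<open>c 16\<close> leaves at most one multiple of 16, namely
  \<open>n 0\<close>, so that \<open>n 1\<close> and \<open>n 2\<close> are exactly 8.\<close>

lemma split_of_2_5_9_12_13:
  assumes "c 2 \<le> 5" "c 2 + c 4 \<le> 9" "c 2 + c 4 + c 8 \<le> 12" "c 2 + c 4 + c 8 + c 16 \<le> 13" "c 3 \<le> 1" "rank_le 1"
  shows "C \<in> split_classes"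
proof -
  consider "c 2 + c 4 \<le> 8" | "c 2 + c 4 + c 8 \<le> 11" | "c 2 = 5 \<and> c 4 = 4 \<and> c 8 = 3 \<and> c 16 \<le> 1"
    using assms count_le by linarith
  then show ?thesis
  proof cases
    case 1
    then show ?thesis
      by (intro split_of_2_5_8 rank_le_mono[OF assms(6)]) (use assms count_le in linarith)+
  next
    case 2
    then show ?thesis
      by (intro split_of_2_5_9_11 rank_le_mono[OF assms(6)]) (use assms count_le in linarith)+
  next
    case 3
    note h = assms(1-5) 3 count_le
    have e8: "n 1 = 8" "n 2 = 8"
      by (rule factor_eq_8[OF assms(6)]; use h in linarith)+
    have e4: "n 3 = 4"
      by (rule factor_eq_4[OF assms(6)]; use h in linarith)+
    have e2: "n 4 = 2"
      by (rule factor_eq_2[OF assms(6)]; use h in linarith)+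
    have e1: "n 5 = 1"
      by (rule factor_eq_1[OF assms(6)]; use h in linarith)+
    have "C = Zmod ([n 0] @ [8, 8, 4, 2])"
      using class_eq[of 5] by (simp add: upt_unfold e8 e4 e2 e1 del: One_nat_def)
    then show ?thesis
      using split_classes_I1(1)[OF Zmod_in_A1_list(1)[OF pos] Zmod_in_B3'_sporadic(2)] pos by simp
  qed
qed

text \<open>Both primes must be extreme at once for \<open>[6, 6, 3, 3]\<close> to appear; slack at
  3 gives rank at most four, slack at 2 the pattern \<open>[3, 3, 3]\<close>.\<close>

lemma split_of_3_5_6_2_3_4:
  assumes "c 3 \<le> 5" "c 3 + c 9 \<le> 6" "c 2 \<le> 3" "c 2 + c 4 \<le> 4" "rank_le 1"
  shows "C \<in> split_classes"
proof -
  consider "c 3 \<le> 4" | "c 2 \<le> 2" | "c 3 = 5 \<and> c 9 \<le> 1 \<and> c 2 = 3 \<and> c 4 \<le> 1"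
    using assms count_le by linarith
  then show ?thesis
  proof cases
    case 1
    then show ?thesis
      by (intro split_of_rank_le_4 rank_le_mono[OF assms(5)]) (use assms count_le in linarith)+
  next
    case 2
    then show ?thesis
      by (intro split_of_3_5_7 rank_le_mono[OF assms(5)]) (use assms count_le in linarith)+
  next
    case 3
    note h = assms(1-4) 3 count_le
    have e6: "n 1 = 6" "n 2 = 6"
      by (rule factor_eq_6[OF assms(5)]; use h in linarith)+
    have e3: "n 3 = 3" "n 4 = 3"
      by (rule factor_eq_3[OF assms(5)]; use h in linarith)+
    have e1: "n 5 = 1"
      by (rule factor_eq_1[OF assms(5)]; use h in linarith)+
    have "C = Zmod ([n 0] @ [6, 6, 3, 3])"
      using class_eq[of 5] by (simp add: upt_unfold e6 e3 e1 del: One_nat_def)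
    then show ?thesis
      using split_classes_I1(1)[OF Zmod_in_A1_list(1)[OF pos] Zmod_in_B3'_sporadic(3)] pos by simp
  qed
qed

lemma split_of_2_5_6_3_4_5:
  assumes "c 2 \<le> 5" "c 2 + c 4 \<le> 6" "c 3 \<le> 4" "c 3 + c 9 \<le> 5" "rank_le 1"
  shows "C \<in> split_classes"
proof -
  consider "c 2 \<le> 4" | "c 3 \<le> 3" | "c 2 = 5 \<and> c 4 \<le> 1 \<and> c 3 = 4 \<and> c 9 \<le> 1"
    using assms count_le by linarith
  then show ?thesis
  proof cases
    case 1
    then show ?thesis
      by (intro split_of_rank_le_4 rank_le_mono[OF assms(5)]) (use assms count_le in linarith)+
  next
    case 2
    then show ?thesis
      by (intro split_of_2_5_8 rank_le_mono[OF assms(5)]) (use assms count_le in linarith)+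
  next
    case 3
    note h = assms(1-4) 3 count_le
    have e6: "n 1 = 6" "n 2 = 6" "n 3 = 6"
      by (rule factor_eq_6[OF assms(5)]; use h in linarith)+
    have e2: "n 4 = 2"
      by (rule factor_eq_2[OF assms(5)]; use h in linarith)+
    have e1: "n 5 = 1"
      by (rule factor_eq_1[OF assms(5)]; use h in linarith)+
    have "C = Zmod ([n 0] @ [6, 6, 6, 2])"
      using class_eq[of 5] by (simp add: upt_unfold e6 e2 e1 del: One_nat_def)
    then show ?thesis
      using split_classes_I1(1)[OF Zmod_in_A1_list(1)[OF pos] Zmod_in_B3'_sporadic(4)] pos by simp
  qed
qed

lemma split_of_2_7_9_9:
  assumes "c 2 \<le> 7" "c 2 + c 4 \<le> 9" "c 2 + c 4 + c 8 \<le> 9" "c 3 \<le> 0" "rank_le 0"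
  shows "C \<in> split_classes"
proof -
  consider "c 2 \<le> 6" | "c 2 + c 4 \<le> 8" | "c 2 = 7 \<and> c 4 = 2 \<and> c 8 = 0"
    using assms count_le by linarith
  then show ?thesis
  proof cases
    case 1
    then show ?thesis
      by (intro split_of_2_6_9_10 rank_le_mono[OF assms(5)]) (use assms count_le in linarith)+
  next
    case 2
    then show ?thesis
      by (intro split_of_2_7_8 rank_le_mono[OF assms(5)]) (use assms count_le in linarith)+
  next
    case 3
    note h = assms(1-4) 3 count_le
    have e4: "n 0 = 4" "n 1 = 4"
      by (rule factor_eq_4[OF assms(5)]; use h in linarith)+
    have e2: "n 2 = 2" "n 3 = 2" "n 4 = 2" "n 5 = 2" "n 6 = 2"
      by (rule factor_eq_2[OF assms(5)]; use h in linarith)+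
    have e1: "n 7 = 1"
      by (rule factor_eq_1[OF assms(5)]; use h in linarith)+
    have "C = Zmod ([4, 4, 2] @ [2, 2, 2, 2])"
      using class_eq[of 7] by (simp add: upt_unfold e4 e2 e1 del: One_nat_def)
    then show ?thesis
      using split_classes_I2[OF Zmod_in_A2_list(1) Zmod_in_A2_list(3)] pos by simp
  qed
qed

lemma split_of_2_8_8:
  assumes "c 2 \<le> 8" "c 2 + c 4 \<le> 8" "c 3 \<le> 0" "rank_le 0"
  shows "C \<in> split_classes"
proof -
  consider "c 2 \<le> 7" | "c 2 = 8 \<and> c 4 = 0"
    using assms count_le by linarith
  then show ?thesis
  proof cases
    case 1
    then show ?thesis
      by (intro split_of_2_7_8 rank_le_mono[OF assms(4)]) (use assms count_le in linarith)+
  next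
    case 2
    note h = assms(1-3) 2 count_le
    have e2: "n 0 = 2" "n 1 = 2" "n 2 = 2" "n 3 = 2" "n 4 = 2" "n 5 = 2" "n 6 = 2" "n 7 = 2"
      by (rule factor_eq_2[OF assms(4)]; use h in linarith)+
    have e1: "n 8 = 1"
      by (rule factor_eq_1[OF assms(4)]; use h in linarith)+
    have "C = Zmod ([2, 2, 2, 2] @ [2, 2, 2, 2])"
      using class_eq[of 8] by (simp add: upt_unfold e2 e1 del: One_nat_def)
    then show ?thesis
      using split_classes_I2[OF Zmod_in_A2_list(3) Zmod_in_A2_list(3)] pos by simp
  qed
qed

text \<open>These bounds belong to \<open>[4, 4, 2] @ [4, 4, 2]\<close> and to
  \<open>[2, 2] @ [4, 4, 4, 4]\<close>. The first case contains the nonsplit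
  \<open>(Z/4)^5\<close>.\<close>

lemma split_of_2_6_10_10:
  assumes "c 2 \<le> 6" "c 2 + c 4 \<le> 10" "c 2 + c 4 + c 8 \<le> 10" "c 3 \<le> 0" "rank_le 0"
  shows "C \<in> split_classes"
proof -
  consider "c 2 \<le> 5" | "c 2 + c 4 \<le> 9" | "c 2 = 6 \<and> c 4 = 4 \<and> c 8 = 0"
    using assms count_le by linarith
  then show ?thesis
  proof cases
    case 1
    then show ?thesis
      by (intro split_of_2_5_10_11 rank_le_mono[OF assms(5)]) (use assms count_le in linarith)+
  next
    case 2
    then show ?thesis
      by (intro split_of_2_6_9_10 rank_le_mono[OF assms(5)]) (use assms count_le in linarith)+
  next
    case 3
    note h = assms(1-4) 3 count_le
    have e4: "n 0 = 4" "n 1 = 4" "n 2 = 4" "n 3 = 4"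
      by (rule factor_eq_4[OF assms(5)]; use h in linarith)+
    have e2: "n 4 = 2" "n 5 = 2"
      by (rule factor_eq_2[OF assms(5)]; use h in linarith)+
    have e1: "n 6 = 1"
      by (rule factor_eq_1[OF assms(5)]; use h in linarith)+
    have "C = Zmod ([4, 4, 4, 4] @ [2, 2])"
      using class_eq[of 6] by (simp add: upt_unfold e4 e2 e1 del: One_nat_def)
    then show ?thesis
      using split_classes_I1(2)[OF Zmod_in_A1_list(2) Zmod_in_B3'_sporadic(1)] pos by simp
  qed
qed

lemma split_of_2_6_9_11_11:
  assumes "c 2 \<le> 6" "c 2 + c 4 \<le> 9" "c 2 + c 4 + c 8 \<le> 11" "c 2 + c 4 + c 8 + c 16 \<le> 11" "c 3 \<le> 0" "rank_le 0"
  shows "C \<in> split_classes"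
proof -
  consider "c 2 \<le> 5" | "c 2 + c 4 \<le> 8" | "c 2 + c 4 + c 8 \<le> 10" | "c 2 = 6 \<and> c 4 = 3 \<and> c 8 = 2 \<and> c 16 = 0"
    using assms count_le by linarith
  then show ?thesis
  proof cases
    case 1
    then show ?thesis
      by (intro split_of_2_5_9_12_13 rank_le_mono[OF assms(6)]) (use assms count_le in linarith)+
  next
    case 2
    then show ?thesis
      by (intro split_of_2_6_8 rank_le_mono[OF assms(6)]) (use assms count_le in linarith)+
  next
    case 3
    then show ?thesis
      by (intro split_of_2_6_9_10 rank_le_mono[OF assms(6)]) (use assms count_le in linarith)+
  next
    case 4
    note h = assms(1-5) 4 count_le
    have e8: "n 0 = 8" "n 1 = 8"
      by (rule factor_eq_8[OF assms(6)]; use h in linarith)+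
    have e4: "n 2 = 4"
      by (rule factor_eq_4[OF assms(6)]; use h in linarith)+
    have e2: "n 3 = 2" "n 4 = 2" "n 5 = 2"
      by (rule factor_eq_2[OF assms(6)]; use h in linarith)+
    have e1: "n 6 = 1"
      by (rule factor_eq_1[OF assms(6)]; use h in linarith)+
    have "C = Zmod ([8, 8, 4, 2] @ [2, 2])"
      using class_eq[of 6] by (simp add: upt_unfold e8 e4 e2 e1 del: One_nat_def)
    then show ?thesis
      using split_classes_I1(2)[OF Zmod_in_A1_list(2) Zmod_in_B3'_sporadic(2)] pos by simp
  qed
qed

lemma split_of_2_6_6_3_3_3:
  assumes "c 2 \<le> 6" "c 2 + c 4 \<le> 6" "c 3 \<le> 3" "c 3 + c 9 \<le> 3" "rank_le 0"
  shows "C \<in> split_classes"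
proof -
  consider "c 2 \<le> 5" | "c 3 \<le> 2" | "c 2 = 6 \<and> c 4 = 0 \<and> c 3 = 3 \<and> c 9 = 0"
    using assms count_le by linarith
  then show ?thesis
  proof cases
    case 1
    then show ?thesis
      by (intro split_of_2_5_8 rank_le_mono[OF assms(5)]) (use assms count_le in linarith)+
  next
    case 2
    then show ?thesis
      by (intro split_of_2_6_8 rank_le_mono[OF assms(5)]) (use assms count_le in linarith)+
  next
    case 3
    note h = assms(1-4) 3 count_le
    have e6: "n 0 = 6" "n 1 = 6" "n 2 = 6"
      by (rule factor_eq_6[OF assms(5)]; use h in linarith)+
    have e2: "n 3 = 2" "n 4 = 2" "n 5 = 2"
      by (rule factor_eq_2[OF assms(5)]; use h in linarith)+
    have e1: "n 6 = 1"
      by (rule factor_eq_1[OF assms(5)]; use h in linarith)+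
    have "C = Zmod ([6, 6, 6, 2] @ [2, 2])"
      using class_eq[of 6] by (simp add: upt_unfold e6 e2 e1 del: One_nat_def)
    then show ?thesis
      using split_classes_I1(2)[OF Zmod_in_A1_list(2) Zmod_in_B3'_sporadic(4)] pos by simp
  qed
qed

lemma split_of_3_6_6:
  assumes "c 3 \<le> 6" "c 3 + c 9 \<le> 6" "c 2 \<le> 0" "rank_le 0"
  shows "C \<in> split_classes"
proof -
  consider "c 3 \<le> 5" | "c 3 = 6 \<and> c 9 = 0"
    using assms count_le by linarith
  then show ?thesis
  proof cases
    case 1
    then show ?thesis
      by (intro split_of_3_5_7 rank_le_mono[OF assms(4)]) (use assms count_le in linarith)+
  next
    case 2
    note h = assms(1-3) 2 count_le
    have e3: "n 0 = 3" "n 1 = 3" "n 2 = 3" "n 3 = 3" "n 4 = 3" "n 5 = 3"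
      by (rule factor_eq_3[OF assms(4)]; use h in linarith)+
    have e1: "n 6 = 1"
      by (rule factor_eq_1[OF assms(4)]; use h in linarith)+
    have "C = Zmod ([3, 3, 3] @ [3, 3, 3])"
      using class_eq[of 6] by (simp add: upt_unfold e3 e1 del: One_nat_def)
    then show ?thesis
      using split_classes_I2[OF Zmod_in_A2_list(2) Zmod_in_A2_list(2)] pos by simp
  qed
qed

end

text \<open>Each alternative lists bounds for the partial sums of the counts at \<open>2\<close>, at \<open>3\<close>, and at a prime
  \<open>p \<ge> 5\<close>; the last are all equal to the count at \<open>5\<close>, as only \<open>0\<close> is divisible by \<open>p\<close>.\<close>

definition admissible_profile :: "nat list \<Rightarrow> bool" where
  "admissible_profile T \<longleftrightarrow>
    (let d = dvd_count T; a1 = d 2; a2 = a1 + d 4; a3 = a2 + d 8; a4 = a3 + d 16;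
         b1 = d 3; b2 = b1 + d 9; r = d 5
     in a1 \<le> 4 \<and> b1 \<le> 4 \<and> r \<le> 4 \<or>
        a1 \<le> 5 \<and> a2 \<le> 8 \<and> b1 \<le> 3 \<and> r \<le> 3 \<or>
        a1 \<le> 5 \<and> a2 \<le> 9 \<and> a3 \<le> 11 \<and> b1 \<le> 2 \<and> r \<le> 2 \<or>
        a1 \<le> 6 \<and> a2 \<le> 8 \<and> b1 \<le> 2 \<and> r \<le> 2 \<or>
        b1 \<le> 5 \<and> b2 \<le> 7 \<and> a1 \<le> 2 \<and> r \<le> 2 \<or>
        a1 \<le> 6 \<and> a2 \<le> 9 \<and> a3 \<le> 10 \<and> b1 \<le> 1 \<and> r \<le> 1 \<or>
        a1 \<le> 7 \<and> a2 \<le> 8 \<and> b1 \<le> 1 \<and> r \<le> 1 \<or>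
        a1 \<le> 5 \<and> a2 \<le> 10 \<and> a3 \<le> 11 \<and> b1 \<le> 1 \<and> r \<le> 1 \<or>
        a1 \<le> 5 \<and> a2 \<le> 9 \<and> a3 \<le> 12 \<and> a4 \<le> 13 \<and> b1 \<le> 1 \<and> r \<le> 1 \<or>
        b1 \<le> 5 \<and> b2 \<le> 6 \<and> a1 \<le> 3 \<and> a2 \<le> 4 \<and> r \<le> 1 \<or>
        a1 \<le> 5 \<and> a2 \<le> 6 \<and> b1 \<le> 4 \<and> b2 \<le> 5 \<and> r \<le> 1 \<or>
        a1 \<le> 7 \<and> a2 \<le> 9 \<and> a3 \<le> 9 \<and> b1 \<le> 0 \<and> r \<le> 0 \<or>
        a1 \<le> 8 \<and> a2 \<le> 8 \<and> b1 \<le> 0 \<and> r \<le> 0 \<or>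
        a1 \<le> 6 \<and> a2 \<le> 10 \<and> a3 \<le> 10 \<and> b1 \<le> 0 \<and> r \<le> 0 \<or>
        a1 \<le> 6 \<and> a2 \<le> 9 \<and> a3 \<le> 11 \<and> a4 \<le> 11 \<and> b1 \<le> 0 \<and> r \<le> 0 \<or>
        a1 \<le> 6 \<and> a2 \<le> 6 \<and> b1 \<le> 3 \<and> b2 \<le> 3 \<and> r \<le> 0 \<or>
        b1 \<le> 6 \<and> b2 \<le> 6 \<and> a1 \<le> 0 \<and> r \<le> 0)"

section \<open>Finite check over all pairs of families\<close>

lemma admissible_profiles:
  "\<forall>S\<in>A1_bounds. \<forall>T\<in>B3_bounds. admissible_profile (S @ T)"
  "\<forall>S\<in>A2_bounds. \<forall>T\<in>A2_bounds. admissible_profile (S @ T)"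
proof -
  \<comment> \<open>The comprehension in \<open>B3_bounds\<close> is spread over explicit finite
    sets for evaluation: 20 triples here, then 8 sporadic pairs, and 25 pairs for the second
    claim.\<close>
  have "\<forall>S\<in>A1_bounds. \<forall>S'\<in>A1_bounds. \<forall>T\<in>A2_bounds. admissible_profile (S @ S' @ T)"
    unfolding A1_bounds_def A2_bounds_def
    by code_simp
  moreover have "\<forall>S\<in>A1_bounds. \<forall>T\<in>{[4, 4, 4, 4], [8, 8, 4, 2], [6, 6, 3, 3], [6, 6, 6, 2]}.
      admissible_profile (S @ T)"
    unfolding A1_bounds_def
    by code_simp
  ultimately show "\<forall>S\<in>A1_bounds. \<forall>T\<in>B3_bounds. admissible_profile (S @ T)"
    unfolding B3_bounds_def by blast
  show "\<forall>S\<in>A2_bounds. \<forall>T\<in>A2_bounds. admissible_profile (S @ T)"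
    unfolding A2_bounds_def
    by code_simp
qed

lemma bounds_entries:
  "S \<in> A1_bounds \<Longrightarrow> T \<in> B3_bounds \<Longrightarrow> set (S @ T) \<subseteq> {0, 2, 3, 4, 6, 8}"
  "S \<in> A2_bounds \<Longrightarrow> T \<in> A2_bounds \<Longrightarrow> set (S @ T) \<subseteq> {0, 2, 3, 4, 6, 8}"
  unfolding A1_bounds_def A2_bounds_def B3_bounds_def by auto

lemma dvd_count_large_prime:
  assumes "Factorial_Ring.prime p" "p \<ge> 5" "set T \<subseteq> {0, 2, 3, 4, 6, 8}"
  shows "dvd_count T p = dvd_count T 5"
proof -
  have "\<not> p dvd 2" "\<not> p dvd 3" "\<not> p dvd 4"
    using assms(2) by (auto dest!: dvd_imp_le)
  moreover have "\<not> p dvd 6"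
    using calculation prime_dvd_multD[OF assms(1), of 2 3] by auto
  moreover have "\<not> p dvd 8"
    using calculation prime_dvd_multD[OF assms(1), of 2 4] by auto
  ultimately have "p dvd m \<longleftrightarrow> 5 dvd m" if "m \<in> {0, 2, 3, 4, 6, 8}" for m
    using that by auto
  then have "filter ((dvd) p) T = filter ((dvd) 5) T"
    using assms(3) by (intro filter_cong) auto
  then show ?thesis
    by (simp add: dvd_count_def)
qed

lemma (in invariant_factors) split_of_admissible_profile:
  assumes "admissible_profile T" "set T \<subseteq> {0, 2, 3, 4, 6, 8}"
    and bound: "\<And>p t. Factorial_Ring.prime p \<Longrightarrow>
      (\<Sum>i=1..t. c (p ^ i)) \<le> (\<Sum>i=1..t. dvd_count T (p ^ i))"
  shows "C \<in> split_classes"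
proof -
  have three: "Factorial_Ring.prime (3::nat)"
    by simp
  have sums: "(\<Sum>i=1..1. f i) = f 1" "(\<Sum>i=1..2. f i) = f 1 + f 2" "(\<Sum>i=1..3. f i) = f 1 + f 2 + f 3"
    "(\<Sum>i=1..4. f i) = f 1 + f 2 + f 3 + f 4" for f :: "nat \<Rightarrow> nat"
    by (simp_all add: eval_nat_numeral)
  have two: "c 2 \<le> dvd_count T 2" "c 2 + c 4 \<le> dvd_count T 2 + dvd_count T 4"
    "c 2 + c 4 + c 8 \<le> dvd_count T 2 + dvd_count T 4 + dvd_count T 8"
    "c 2 + c 4 + c 8 + c 16 \<le> dvd_count T 2 + dvd_count T 4 + dvd_count T 8 + dvd_count T 16"
    using bound[OF two_is_prime_nat, of 1] bound[OF two_is_prime_nat, of 2]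
      bound[OF two_is_prime_nat, of 3] bound[OF two_is_prime_nat, of 4] unfolding sums by simp_all
  have three: "c 3 \<le> dvd_count T 3" "c 3 + c 9 \<le> dvd_count T 3 + dvd_count T 9"
    using bound[OF three, of 1] bound[OF three, of 2] unfolding sums by simp_all
  \<comment> \<open>For primes from 5 on, \<open>t = 1\<close> is enough, and the bound is the same
    for all of them: the number of entries 0 in \<open>T\<close>.\<close>
  have "rank_le (dvd_count T 5)"
    unfolding rank_le_def
  proof (intro allI impI)
    fix p :: nat assume p: "Factorial_Ring.prime p" "p \<ge> 5"
    then show "c p \<le> dvd_count T 5"
      using bound[OF p(1), of 1] dvd_count_large_prime[OF p assms(2)] unfolding sums by simp
  qed
  then have rank: "rank_le k" if "dvd_count T 5 \<le> k" for k
    using that by (rule rank_le_mono)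
  show ?thesis
    using assms(1) unfolding admissible_profile_def Let_def
    apply (elim disjE conjE)
    subgoal by (intro split_of_rank_le_4 rank) (use two three in linarith)+
    subgoal by (intro split_of_2_5_8 rank) (use two three in linarith)+
    subgoal by (intro split_of_2_5_9_11 rank) (use two three in linarith)+
    subgoal by (intro split_of_2_6_8 rank) (use two three in linarith)+
    subgoal by (intro split_of_3_5_7 rank) (use two three in linarith)+
    subgoal by (intro split_of_2_6_9_10 rank) (use two three in linarith)+
    subgoal by (intro split_of_2_7_8 rank) (use two three in linarith)+
    subgoal by (intro split_of_2_5_10_11 rank) (use two three in linarith)+
    subgoal by (intro split_of_2_5_9_12_13 rank) (use two three in linarith)+
    subgoal by (intro split_of_3_5_6_2_3_4 rank) (use two three in linarith)+
    subgoal by (intro split_of_2_5_6_3_4_5 rank) (use two three in linarith)+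
    subgoal by (intro split_of_2_7_9_9 rank) (use two three in linarith)+
    subgoal by (intro split_of_2_8_8 rank) (use two three in linarith)+
    subgoal by (intro split_of_2_6_10_10 rank) (use two three in linarith)+
    subgoal by (intro split_of_2_6_9_11_11 rank) (use two three in linarith)+
    subgoal by (intro split_of_2_6_6_3_3_3 rank) (use two three in linarith)+
    subgoal by (intro split_of_3_6_6 rank) (use two three in linarith)+
    done
qed

text \<open>At \<open>p ^ t\<close> both sides of the torsion bound are powers of \<open>p\<close>,
  so the inequality passes to the exponents, which are the partial sums of the counts.\<close>

lemma split_of_torsion_bounded:
  fixes G :: "nat monoid"
  assumes "fin_ab_group G" "torsion_bounded T G" "admissible_profile T" "set T \<subseteq> {0, 2, 3, 4, 6, 8}"
  shows "iso_class G \<in> split_classes"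
proof -
  obtain ns where ns: "G \<cong> cyclic_prod ns" "\<forall>m\<in>set ns. m > 1" "sorted_wrt (\<lambda>a b. b dvd a) ns"
    using invariant_factor_decomposition[OF assms(1)] .
  note G = fin_ab_group_imp_group[OF assms(1)]
  have ns_pos: "\<forall>m\<in>set ns. m > 0"
    using ns(2) by auto
  have class_eq: "iso_class G = Zmod ns"
    unfolding Zmod_cyclic_prod by (rule iso_class_eqI[OF G group_cyclic_prod ns(1)])
  interpret invariant_factors "nth_default 1 ns" "dvd_count ns" "iso_class G"
  proof
    show "nth_default 1 ns i > 0" for i
      using ns_pos by (simp add: nth_default_def)
    show "q dvd nth_default 1 ns i \<longleftrightarrow> i < dvd_count ns q" if "q \<noteq> 1" for q i
      by (rule dvd_nth_iff_less_dvd_count[OF ns(3) that])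
    show "iso_class G = Zmod (map (nth_default 1 ns) [0..<r])" if "nth_default 1 ns r = 1" for r
    proof -
      \<comment> \<open>All entries of \<open>ns\<close> exceed 1, so the value 1 can only be the
        default beyond the end.\<close>
      have r: "length ns \<le> r"
      proof (rule ccontr)
        assume "\<not> length ns \<le> r"
        then have "ns ! r = 1" "ns ! r > 1"
          using that bspec[OF ns(2) nth_mem[of r ns]] by (simp_all add: nth_default_def)
        then show False
          by simp
      qed
      have "map (nth_default 1 ns) [0..<r] = ns @ replicate (r - length ns) 1"
        by (rule nth_equalityI) (use r in \<open>auto simp: nth_default_def nth_append\<close>)
      then show ?thesis
        by (simp only: class_eq Zmod_append_ones)
    qed
  qed
  show ?thesis
  proof (rule split_of_admissible_profile[OF assms(3,4)])
    fix p t :: nat assume p: "Factorial_Ring.prime p"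
    have "p ^ (\<Sum>i=1..t. dvd_count ns (p ^ i)) = torsion_card (cyclic_prod ns) (p ^ t)"
      using ns_pos by (simp add: torsion_card_cyclic_prod prod_list_gcd_prime_power[OF p])
    also have "\<dots> = torsion_card G (p ^ t)"
      using torsion_card_iso[OF G group_cyclic_prod ns(1)] by simp
    also have "\<dots> \<le> (\<Prod>m\<leftarrow>T. gcd (p ^ t) m)"
      using assms(2) prime_gt_0_nat[OF p] by (simp add: torsion_bounded_def)
    also have "\<dots> = p ^ (\<Sum>i=1..t. dvd_count T (p ^ i))"
      by (rule prod_list_gcd_prime_power[OF p])
    finally show "(\<Sum>i=1..t. dvd_count ns (p ^ i)) \<le> (\<Sum>i=1..t. dvd_count T (p ^ i))"
      using prime_gt_1_nat[OF p] by (simp only: power_increasing_iff)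
  qed
qed

theorem theorem15:
  shows "((A1_list \<bullet>\<^sub>G B3' A1_list A2_list) \<union> (A2_list \<bullet>\<^sub>G A2_list) =
          (A1_list \<times>\<^sub>G B3' A1_list A2_list) \<union> (A2_list \<times>\<^sub>G A2_list)) \<and>
         (A_Cr 1 = A1_list \<longrightarrow> A_Cr 2 = A2_list \<longrightarrow>
          (A_Cr 1 \<bullet>\<^sub>G B3' (A_Cr 1) (A_Cr 2)) \<union> (A_Cr 2 \<bullet>\<^sub>G A_Cr 2) =
          (A_Cr 1 \<times>\<^sub>G B3' (A_Cr 1) (A_Cr 2)) \<union> (A_Cr 2 \<times>\<^sub>G A_Cr 2))"
proof -
  have "A1_list \<bullet>\<^sub>G B3' A1_list A2_list \<subseteq> split_classes"
  proof
    fix D assume "D \<in> A1_list \<bullet>\<^sub>G B3' A1_list A2_list"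
    then obtain G :: "nat monoid" and S T where "D = iso_class G" "fin_ab_group G" "S \<in> A1_bounds"
      "T \<in> B3_bounds" "torsion_bounded (S @ T) G"
      by (rule class_ext_torsion_bounded[OF _ A1_torsion_bounded B3_torsion_bounded])
    then show "D \<in> split_classes"
      using split_of_torsion_bounded admissible_profiles(1) bounds_entries(1) by simp
  qed
  moreover have "A2_list \<bullet>\<^sub>G A2_list \<subseteq> split_classes"
  proof
    fix D assume "D \<in> A2_list \<bullet>\<^sub>G A2_list"
    then obtain G :: "nat monoid" and S T where "D = iso_class G" "fin_ab_group G" "S \<in> A2_bounds"
      "T \<in> A2_bounds" "torsion_bounded (S @ T) G"
      by (rule class_ext_torsion_bounded[OF _ A2_torsion_bounded A2_torsion_bounded])
    then show "D \<in> split_classes"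
      using split_of_torsion_bounded admissible_profiles(2) bounds_entries(2) by simp
  qed
  ultimately have "(A1_list \<bullet>\<^sub>G B3' A1_list A2_list) \<union> (A2_list \<bullet>\<^sub>G A2_list) = split_classes"
    using class_times_subset_class_ext by blast
  \<comment> \<open>Substituting the two classifications turns the second conjunct into the
    first.\<close>
  then show ?thesis
    by simp
qed

end
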